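(* The Markov category $\mathsf{BKer}$ is causal: for all morphisms $f:A\to B$, $g:B\to C$ and $h_1,h_2:C\to D$ of $\mathsf{BKer}$, if the two composites $$(h_i\otimes 1_C)\circ\mathsf{copy}_C\circ g\circ f:A\to D\otimes C\qquad(i=1,2)$$ are equal, then the two composites $$\big(((h_i\otimes 1_C)\circ\mathsf{copy}_C\circ g)\otimes 1_B\big)\circ\mathsf{copy}_B\circ f:A\to D\otimes C\otimes B\qquad(i=1,2)$$ are equal.
   Context: $\mathsf{EAlg}$ is the category of effect algebras: partial commutative monoids $(E,\oplus,0)$ with an element $1$ such that every $a$ has a unique $a^\perp$ with $a\oplus a^\perp=1$, and such that $a\oplus1$ defined implies $a=0$; morphisms preserve $1$ and all defined sums. Every Boolean algebra is an effect algebra, with $a\oplus b$ defined iff $a\wedge b=0$, and then $a\oplus b=a\vee b$; the category $\mathsf{BAlg}$ of Boolean algebras is a full subcategory of $\mathsf{EAlg}$. $\otimes$ is the tensor product of effect algebras (universal for bimorphisms, i.e. maps additive in each variable and sending $(1,1)$ to $1$), with unit $\mathbb{2}=\{\bot,\top\}$, the initial object of $\mathsf{EAlg}$; for Boolean algebras $A,B$, $A\otimes B$ is their coproduct $A+_{\mathsf{BAlg}}B$ in $\mathsf{BAlg}$. $\mathbb{I}$ is the effect algebra $[0,1]$ with $a\oplus b$ defined iff $a+b\le1$, and then equal to $a+b$. It is a monoid for $\otimes$, with multiplication $\mathbb{I}\otimes\mathbb{I}\to\mathbb{I}$ induced by multiplication of reals and unit the unique map $\mathbb{2}\to\mathbb{I}$,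 so $\mathbb{I}\otimes(-)$ is a monad on $\mathsf{EAlg}$. $\mathsf{BKer}$ is the opposite of the Kleisli category of the monad $\mathbb{I}\otimes(-)$ on $\mathsf{EAlg}$, restricted to the objects of $\mathsf{BAlg}$: objects are Boolean algebras, and morphisms $A\to B$ are maps $B\to\mathbb{I}\otimes A$ in $\mathsf{EAlg}$. The tensor on objects is $A\otimes B$; morphisms given by $f:B\to\mathbb{I}\otimes A$ and $f':B'\to\mathbb{I}\otimes A'$ are tensored as $B\otimes B'\to\mathbb{I}\otimes A\otimes\mathbb{I}\otimes A'\cong\mathbb{I}\otimes\mathbb{I}\otimes A\otimes A'\to\mathbb{I}\otimes A\otimes A'$. The monoidal unit is $\mathbb{2}$. The discard map of $A$ is the unique map $\mathbb{2}\to\mathbb{I}\otimes A$, and the copy map $\mathsf{copy}_A:A\to A\otimes A$ of $\mathsf{BKer}$ is the map $A\otimes A\cong A+_{\mathsf{BAlg}}A\to A\cong\mathbb{2}\otimes A\to\mathbb{I}\otimes A$ given by the codiagonal followed by the unit of $\mathbb{I}$. *)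

theory Defs
  imports Complex_Main "HOL-Library.FuncSet" "HOL-Library.Multiset"
begin

section \<open>Effect algebras\<close>

record 'a ea =
  carrier :: "'a set"
  oplus :: "'a \<Rightarrow> 'a \<Rightarrow> 'a option" (infixl \<open>\<oplus>\<index>\<close> 65)
  ezero :: 'a (\<open>\<zero>\<index>\<close>)
  eone :: 'a (\<open>\<one>\<index>\<close>)

text \<open>
  The partial sum takes values in an option type, and \<^term>\<open>None\<close> means undefined. The values
  of \<^const>\<open>oplus\<close> on arguments outside the carrier are irrelevant. The degenerate effect algebra
  with \<open>\<zero> = \<one>\<close> is allowed.
\<close>

locale effect_algebra =
  fixes E :: "'a ea" (structure)
  assumes zero_closed: "\<zero> \<in> carrier E"
    and one_closed: "\<one> \<in> carrier E"
    and oplus_closed: "\<lbrakk>a \<in> carrier E; b \<in> carrier E; a \<oplus> b = Some c\<rbrakk> \<Longrightarrow> c \<in> carrier E"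
    and oplus_comm: "\<lbrakk>a \<in> carrier E; b \<in> carrier E\<rbrakk> \<Longrightarrow> a \<oplus> b = b \<oplus> a"
    and oplus_assoc: "\<lbrakk>a \<in> carrier E; b \<in> carrier E; c \<in> carrier E\<rbrakk> \<Longrightarrow>
      Option.bind (a \<oplus> b) (\<lambda>x. x \<oplus> c) = Option.bind (b \<oplus> c) (\<lambda>x. a \<oplus> x)"
    and oplus_zero: "a \<in> carrier E \<Longrightarrow> \<zero> \<oplus> a = Some a"
    and orthocomplement: "a \<in> carrier E \<Longrightarrow> \<exists>!b. b \<in> carrier E \<and> a \<oplus> b = Some \<one>"
    and zero_one_law: "\<lbrakk>a \<in> carrier E; a \<oplus> \<one> \<noteq> None\<rbrakk> \<Longrightarrow> a = \<zero>"

text \<open>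
  Arrows carry their domain and codomain, and their underlying functions are extensional, so that
  HOL equality of arrows is equality of morphisms.
\<close>

record ('a, 'b) ea_arrow =
  Dom :: "'a ea"
  Cod :: "'b ea"
  app :: "'a \<Rightarrow> 'b"

definition EAlg :: "'a ea \<Rightarrow> 'b ea \<Rightarrow> ('a, 'b) ea_arrow set" where
  "EAlg E F = {f. Dom f = E \<and> Cod f = F \<and> app f \<in> carrier E \<rightarrow>\<^sub>E carrier F \<and>
     app f \<one>\<^bsub>E\<^esub> = \<one>\<^bsub>F\<^esub> \<and>
     (\<forall>a\<in>carrier E. \<forall>b\<in>carrier E. \<forall>c. a \<oplus>\<^bsub>E\<^esub> b = Some c \<longrightarrow>
        app f a \<oplus>\<^bsub>F\<^esub> app f b = Some (app f c))}"

definition ea_id :: "'a ea \<Rightarrow> ('a, 'a) ea_arrow" where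
  "ea_id E = \<lparr>Dom = E, Cod = E, app = restrict (\<lambda>a. a) (carrier E)\<rparr>"

definition ea_comp :: "('b, 'c) ea_arrow \<Rightarrow> ('a, 'b) ea_arrow \<Rightarrow> ('a, 'c) ea_arrow"
    (infixl \<open>\<circ>\<^sub>E\<close> 55) where
  "g \<circ>\<^sub>E f = \<lparr>Dom = Dom f, Cod = Cod g, app = compose (carrier (Dom f)) (app g) (app f)\<rparr>"


section \<open>Boolean algebras\<close>

locale boolean_algebra_on =
  fixes B :: "'a set" and meet join :: "'a \<Rightarrow> 'a \<Rightarrow> 'a" and compl :: "'a \<Rightarrow> 'a" and bt tp :: 'a
  assumes meet_closed: "\<lbrakk>x \<in> B; y \<in> B\<rbrakk> \<Longrightarrow> meet x y \<in> B"
    and join_closed: "\<lbrakk>x \<in> B; y \<in> B\<rbrakk> \<Longrightarrow> join x y \<in> B"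
    and compl_closed: "x \<in> B \<Longrightarrow> compl x \<in> B"
    and bot_closed: "bt \<in> B"
    and top_closed: "tp \<in> B"
    and meet_comm: "\<lbrakk>x \<in> B; y \<in> B\<rbrakk> \<Longrightarrow> meet x y = meet y x"
    and join_comm: "\<lbrakk>x \<in> B; y \<in> B\<rbrakk> \<Longrightarrow> join x y = join y x"
    and meet_assoc: "\<lbrakk>x \<in> B; y \<in> B; z \<in> B\<rbrakk> \<Longrightarrow> meet (meet x y) z = meet x (meet y z)"
    and join_assoc: "\<lbrakk>x \<in> B; y \<in> B; z \<in> B\<rbrakk> \<Longrightarrow> join (join x y) z = join x (join y z)"
    and meet_join_absorb: "\<lbrakk>x \<in> B; y \<in> B\<rbrakk> \<Longrightarrow> meet x (join x y) = x"
    and join_meet_absorb: "\<lbrakk>x \<in> B; y \<in> B\<rbrakk> \<Longrightarrow> join x (meet x y) = x"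
    and meet_join_distrib: "\<lbrakk>x \<in> B; y \<in> B; z \<in> B\<rbrakk> \<Longrightarrow>
      meet x (join y z) = join (meet x y) (meet x z)"
    and join_bot: "x \<in> B \<Longrightarrow> join x bt = x"
    and meet_top: "x \<in> B \<Longrightarrow> meet x tp = x"
    and meet_compl: "x \<in> B \<Longrightarrow> meet x (compl x) = bt"
    and join_compl: "x \<in> B \<Longrightarrow> join x (compl x) = tp"

text \<open>
  \<open>BAlg\<close> is a full subcategory of \<open>EAlg\<close>; this predicate selects its objects. The Boolean
  operations are determined by the effect algebra, so they need not be part of the data.
\<close>

definition BAlg :: "'a ea \<Rightarrow> bool" where
  "BAlg E \<longleftrightarrow> (\<exists>meet join compl.
     boolean_algebra_on (carrier E) meet join compl \<zero>\<^bsub>E\<^esub> \<one>\<^bsub>E\<^esub> \<and>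
     (\<forall>a\<in>carrier E. \<forall>b\<in>carrier E.
        a \<oplus>\<^bsub>E\<^esub> b = (if meet a b = \<zero>\<^bsub>E\<^esub> then Some (join a b) else None)))"


section \<open>The tensor product\<close>

definition biadditive :: "'a ea \<Rightarrow> 'b ea \<Rightarrow> 'c ea \<Rightarrow> ('a \<Rightarrow> 'b \<Rightarrow> 'c) \<Rightarrow> bool" where
  "biadditive E F G \<beta> \<longleftrightarrow>
     (\<forall>a\<in>carrier E. \<forall>b\<in>carrier F. \<beta> a b \<in> carrier G) \<and>
     (\<forall>a\<in>carrier E. \<forall>a'\<in>carrier E. \<forall>b\<in>carrier F. \<forall>c. a \<oplus>\<^bsub>E\<^esub> a' = Some c \<longrightarrow>
        \<beta> a b \<oplus>\<^bsub>G\<^esub> \<beta> a' b = Some (\<beta> c b)) \<and>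
     (\<forall>a\<in>carrier E. \<forall>b\<in>carrier F. \<forall>b'\<in>carrier F. \<forall>c. b \<oplus>\<^bsub>F\<^esub> b' = Some c \<longrightarrow>
        \<beta> a b \<oplus>\<^bsub>G\<^esub> \<beta> a b' = Some (\<beta> a c))"

definition bimorphism :: "'a ea \<Rightarrow> 'b ea \<Rightarrow> 'c ea \<Rightarrow> ('a \<Rightarrow> 'b \<Rightarrow> 'c) \<Rightarrow> bool" where
  "bimorphism E F G \<beta> \<longleftrightarrow> biadditive E F G \<beta> \<and> \<beta> \<one>\<^bsub>E\<^esub> \<one>\<^bsub>F\<^esub> = \<one>\<^bsub>G\<^esub>"

text \<open>
  \<open>E \<otimes> F\<close> is built from formal finite sums of pairs, i.e. multisets, modulo the least congruence
  that is biadditive and under which \<open>(1, 1)\<close> behaves as the top element of an effect algebra: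
  orthocomplements are unique (rule \<open>ortho\<close>) and nonzero elements have no negatives (rule
  \<open>positive\<close>). Its elements are the classes of the formal sums below \<open>(1, 1)\<close>. The theorem
  \<open>tensor_universal\<close> at the end of this theory is the universal property.
\<close>

inductive tcong :: "'a ea \<Rightarrow> 'b ea \<Rightarrow> ('a \<times> 'b) multiset \<Rightarrow> ('a \<times> 'b) multiset \<Rightarrow> bool"
  for E :: "'a ea" and F :: "'b ea" where
  refl: "set_mset x \<subseteq> carrier E \<times> carrier F \<Longrightarrow> tcong E F x x"
| sym: "tcong E F x y \<Longrightarrow> tcong E F y x"
| trans: "\<lbrakk>tcong E F x y; tcong E F y z\<rbrakk> \<Longrightarrow> tcong E F x z"
| add: "\<lbrakk>tcong E F x y; set_mset z \<subseteq> carrier E \<times> carrier F\<rbrakk> \<Longrightarrow> tcong E F (x + z) (y + z)"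
| left: "\<lbrakk>a \<in> carrier E; a' \<in> carrier E; b \<in> carrier F; a \<oplus>\<^bsub>E\<^esub> a' = Some c\<rbrakk> \<Longrightarrow>
    tcong E F {#(a, b), (a', b)#} {#(c, b)#}"
| right: "\<lbrakk>a \<in> carrier E; b \<in> carrier F; b' \<in> carrier F; b \<oplus>\<^bsub>F\<^esub> b' = Some c\<rbrakk> \<Longrightarrow>
    tcong E F {#(a, b), (a, b')#} {#(a, c)#}"
| ortho: "\<lbrakk>tcong E F (x + y) {#(\<one>\<^bsub>E\<^esub>, \<one>\<^bsub>F\<^esub>)#}; tcong E F (x + z) {#(\<one>\<^bsub>E\<^esub>, \<one>\<^bsub>F\<^esub>)#}\<rbrakk> \<Longrightarrow> tcong E F y z"
| positive: "tcong E F (x + y) {#} \<Longrightarrow> tcong E F x {#}"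

definition tclass :: "'a ea \<Rightarrow> 'b ea \<Rightarrow> ('a \<times> 'b) multiset \<Rightarrow> ('a \<times> 'b) multiset set" where
  "tclass E F x = {y. tcong E F x y}"

definition tcarrier :: "'a ea \<Rightarrow> 'b ea \<Rightarrow> ('a \<times> 'b) multiset set set" where
  "tcarrier E F = {tclass E F x |x y. tcong E F (x + y) {#(\<one>\<^bsub>E\<^esub>, \<one>\<^bsub>F\<^esub>)#}}"

definition tensor :: "'a ea \<Rightarrow> 'b ea \<Rightarrow> ('a \<times> 'b) multiset set ea" (infixl \<open>\<otimes>\<close> 70) where
  "E \<otimes> F = \<lparr>carrier = tcarrier E F,
     oplus = (\<lambda>X Y. let Z = {z. \<exists>x\<in>X. \<exists>y\<in>Y. tcong E F (x + y) z} in
                if Z \<in> tcarrier E F then Some Z else None),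
     ezero = tclass E F {#},
     eone = tclass E F {#(\<one>\<^bsub>E\<^esub>, \<one>\<^bsub>F\<^esub>)#}\<rparr>"

definition pure :: "'a ea \<Rightarrow> 'b ea \<Rightarrow> 'a \<Rightarrow> 'b \<Rightarrow> ('a \<times> 'b) multiset set" where
  "pure E F a b = tclass E F {#(a, b)#}"

text \<open>The mediating morphism of a bimorphism.\<close>

definition tensor_lift ::
    "'a ea \<Rightarrow> 'b ea \<Rightarrow> 'c ea \<Rightarrow> ('a \<Rightarrow> 'b \<Rightarrow> 'c) \<Rightarrow> (('a \<times> 'b) multiset set, 'c) ea_arrow" where
  "tensor_lift E F G \<beta> = (THE h. h \<in> EAlg (E \<otimes> F) G \<and>
     (\<forall>a\<in>carrier E. \<forall>b\<in>carrier F. app h (pure E F a b) = \<beta> a b))"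


section \<open>Monoidal structure of \<open>EAlg\<close>\<close>

definition tensor_map :: "('a, 'b) ea_arrow \<Rightarrow> ('c, 'd) ea_arrow \<Rightarrow>
    (('a \<times> 'c) multiset set, ('b \<times> 'd) multiset set) ea_arrow" (infixl \<open>\<otimes>\<^sub>E\<close> 70) where
  "f \<otimes>\<^sub>E g = tensor_lift (Dom f) (Dom g) (Cod f \<otimes> Cod g)
     (\<lambda>a b. pure (Cod f) (Cod g) (app f a) (app g b))"

definition ea_sym :: "'a ea \<Rightarrow> 'b ea \<Rightarrow>
    (('a \<times> 'b) multiset set, ('b \<times> 'a) multiset set) ea_arrow" where
  "ea_sym E F = tensor_lift E F (F \<otimes> E) (\<lambda>a b. pure F E b a)"

definition ea_assoc :: "'a ea \<Rightarrow> 'b ea \<Rightarrow> 'c ea \<Rightarrow>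
    ((('a \<times> 'b) multiset set \<times> 'c) multiset set,
     ('a \<times> ('b \<times> 'c) multiset set) multiset set) ea_arrow" where
  "ea_assoc E F G = (THE h. h \<in> EAlg ((E \<otimes> F) \<otimes> G) (E \<otimes> (F \<otimes> G)) \<and>
     (\<forall>a\<in>carrier E. \<forall>b\<in>carrier F. \<forall>c\<in>carrier G.
        app h (pure (E \<otimes> F) G (pure E F a b) c) = pure E (F \<otimes> G) a (pure F G b c)))"

definition ea_assoc_inv :: "'a ea \<Rightarrow> 'b ea \<Rightarrow> 'c ea \<Rightarrow>
    (('a \<times> ('b \<times> 'c) multiset set) multiset set,
     (('a \<times> 'b) multiset set \<times> 'c) multiset set) ea_arrow" where
  "ea_assoc_inv E F G = (THE h. h \<in> EAlg (E \<otimes> (F \<otimes> G)) ((E \<otimes> F) \<otimes> G) \<and>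
     (\<forall>a\<in>carrier E. \<forall>b\<in>carrier F. \<forall>c\<in>carrier G.
        app h (pure E (F \<otimes> G) a (pure F G b c)) = pure (E \<otimes> F) G (pure E F a b) c))"

definition two :: "bool ea" (\<open>\<two>\<close>) where
  "\<two> = \<lparr>carrier = UNIV, oplus = (\<lambda>p q. if p \<and> q then None else Some (p \<or> q)),
     ezero = False, eone = True\<rparr>"

definition ea_unitor_inv :: "'a ea \<Rightarrow> ('a, (bool \<times> 'a) multiset set) ea_arrow" where
  "ea_unitor_inv A = \<lparr>Dom = A, Cod = \<two> \<otimes> A, app = restrict (pure \<two> A True) (carrier A)\<rparr>"


section \<open>The monoid \<open>\<I>\<close> and its monad\<close>

definition unit_interval :: "real ea" (\<open>\<I>\<close>) where
  "\<I> = \<lparr>carrier = {0..1}, oplus = (\<lambda>a b. if a + b \<le> 1 then Some (a + b) else None),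
     ezero = 0, eone = 1\<rparr>"

definition I_mult :: "((real \<times> real) multiset set, real) ea_arrow" where
  "I_mult = tensor_lift \<I> \<I> \<I> (*)"

definition I_unit :: "(bool, real) ea_arrow" where
  "I_unit = (THE u. u \<in> EAlg \<two> \<I>)"

type_synonym 'a I_tensor = "(real \<times> 'a) multiset set"

definition monad_unit :: "'a ea \<Rightarrow> ('a, 'a I_tensor) ea_arrow" where
  "monad_unit A = (I_unit \<otimes>\<^sub>E ea_id A) \<circ>\<^sub>E ea_unitor_inv A"

definition monad_mult :: "'a ea \<Rightarrow> ('a I_tensor I_tensor, 'a I_tensor) ea_arrow" where
  "monad_mult A = (I_mult \<otimes>\<^sub>E ea_id A) \<circ>\<^sub>E ea_assoc_inv \<I> \<I> A"


section \<open>The category \<open>BKer\<close>\<close>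

text \<open>
  A morphism \<open>A \<rightarrow> B\<close> consists of its source \<open>A\<close> and an arrow \<open>B \<rightarrow> \<I> \<otimes> A\<close> of \<open>EAlg\<close>; its target
  is the domain of that arrow.
\<close>

record ('a, 'b) kernel =
  Src :: "'a ea"
  Arr :: "('b, 'a I_tensor) ea_arrow"

definition BKer :: "'a ea \<Rightarrow> 'b ea \<Rightarrow> ('a, 'b) kernel set" where
  "BKer A B = {f. BAlg A \<and> BAlg B \<and> Src f = A \<and> Arr f \<in> EAlg B (\<I> \<otimes> A)}"

definition ker_id :: "'a ea \<Rightarrow> ('a, 'a) kernel" where
  "ker_id A = \<lparr>Src = A, Arr = monad_unit A\<rparr>"

definition ker_comp :: "('b, 'c) kernel \<Rightarrow> ('a, 'b) kernel \<Rightarrow> ('a, 'c) kernel"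
    (infixl \<open>\<circ>\<^sub>K\<close> 55) where
  "g \<circ>\<^sub>K f = \<lparr>Src = Src f,
     Arr = monad_mult (Src f) \<circ>\<^sub>E (ea_id \<I> \<otimes>\<^sub>E Arr f) \<circ>\<^sub>E Arr g\<rparr>"

text \<open>The canonical isomorphism \<open>(\<I> \<otimes> A) \<otimes> (\<I> \<otimes> A') \<cong> (\<I> \<otimes> \<I>) \<otimes> (A \<otimes> A')\<close>.\<close>

definition interchange :: "'a ea \<Rightarrow> 'b ea \<Rightarrow>
    (('a I_tensor \<times> 'b I_tensor) multiset set,
     ((real \<times> real) multiset set \<times> ('a \<times> 'b) multiset set) multiset set) ea_arrow" where
  "interchange A A' =
     ea_assoc_inv \<I> \<I> (A \<otimes> A')
     \<circ>\<^sub>E (ea_id \<I> \<otimes>\<^sub>E (ea_assoc \<I> A A' \<circ>\<^sub>E (ea_sym A \<I> \<otimes>\<^sub>E ea_id A') \<circ>\<^sub>E ea_assoc_inv A \<I> A'))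
     \<circ>\<^sub>E ea_assoc \<I> A (\<I> \<otimes> A')"

definition ker_tensor :: "('a, 'b) kernel \<Rightarrow> ('c, 'd) kernel \<Rightarrow>
    (('a \<times> 'c) multiset set, ('b \<times> 'd) multiset set) kernel" (infixl \<open>\<otimes>\<^sub>K\<close> 70) where
  "f \<otimes>\<^sub>K f' = \<lparr>Src = Src f \<otimes> Src f',
     Arr = (I_mult \<otimes>\<^sub>E ea_id (Src f \<otimes> Src f')) \<circ>\<^sub>E interchange (Src f) (Src f')
           \<circ>\<^sub>E (Arr f \<otimes>\<^sub>E Arr f')\<rparr>"

text \<open>
  For Boolean \<open>A\<close>, \<open>A \<otimes> A\<close> is the coproduct of \<open>A\<close> with itself in \<open>BAlg\<close>, with coprojections
  \<open>a \<mapsto> a \<otimes> 1\<close> and \<open>b \<mapsto> 1 \<otimes> b\<close>; the codiagonal is the copairing of two identities.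
\<close>

definition codiagonal :: "'a ea \<Rightarrow> (('a \<times> 'a) multiset set, 'a) ea_arrow" where
  "codiagonal A = (THE h. h \<in> EAlg (A \<otimes> A) A \<and>
     (\<forall>a\<in>carrier A. app h (pure A A a \<one>\<^bsub>A\<^esub>) = a \<and> app h (pure A A \<one>\<^bsub>A\<^esub> a) = a))"

definition ker_copy :: "'a ea \<Rightarrow> ('a, ('a \<times> 'a) multiset set) kernel" where
  "ker_copy A = \<lparr>Src = A, Arr = monad_unit A \<circ>\<^sub>E codiagonal A\<rparr>"


section \<open>The universal property of the tensor product\<close>

context effect_algebra
begin

lemma oplus_zero_right: "a \<in> carrier E \<Longrightarrow> a \<oplus> \<zero> = Some a"
  using oplus_zero oplus_comm zero_closed by metis

lemma assocE:
  assumes "a \<in> carrier E" "b \<in> carrier E" "c \<in> carrier E" "a \<oplus> b = Some x" "x \<oplus> c = Some y"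
  obtains z where "z \<in> carrier E" "b \<oplus> c = Some z" "a \<oplus> z = Some y"
proof -
  have "Option.bind (b \<oplus> c) (\<lambda>z. a \<oplus> z) = Some y"
    using oplus_assoc[OF assms(1-3)] assms(4,5) by simp
  then obtain z where "b \<oplus> c = Some z" "a \<oplus> z = Some y" by (auto simp: bind_eq_Some_conv)
  then show thesis using that oplus_closed assms by blast
qed

lemma oplus_cancel:
  assumes "a \<in> carrier E" "b \<in> carrier E" "c \<in> carrier E" "a \<oplus> b = Some x" "a \<oplus> c = Some x"
  shows "b = c"
proof -
  have x: "x \<in> carrier E" using assms oplus_closed by blast
  obtain y where y: "y \<in> carrier E" "x \<oplus> y = Some \<one>" using orthocomplement[OF x] by blast
  have "b \<oplus> a = Some x" "c \<oplus> a = Some x" using assms oplus_comm by metis+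
  then obtain z z' where z: "a \<oplus> y = Some z" "b \<oplus> z = Some \<one>" "a \<oplus> y = Some z'" "c \<oplus> z' = Some \<one>"
      "z \<in> carrier E"
    using assocE assms y by metis
  then have "z \<oplus> b = Some \<one>" "z \<oplus> c = Some \<one>" using oplus_comm assms by (metis option.inject)+
  then show ?thesis using orthocomplement[OF z(5)] assms by blast
qed

lemma oplus_eq_zero:
  assumes "a \<in> carrier E" "b \<in> carrier E" "a \<oplus> b = Some \<zero>"
  shows "a = \<zero>"
proof -
  have "b \<oplus> a = Some \<zero>" using assms oplus_comm by metis
  then obtain z where "a \<oplus> \<one> = Some z"
    using assocE[OF assms(2,1) one_closed _ oplus_zero[OF one_closed]] by metis
  then show ?thesis using zero_one_law assms by simp
qed

end

lemma tcong_set: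
  assumes "effect_algebra E" "effect_algebra F" "tcong E F x y"
  shows "set_mset x \<subseteq> carrier E \<times> carrier F \<and> set_mset y \<subseteq> carrier E \<times> carrier F"
  using assms(3)
proof (induction rule: tcong.induct)
  case (left a a' b c)
  then have "c \<in> carrier E" using effect_algebra.oplus_closed[OF assms(1)] by blast
  then show ?case using left by simp
next
  case (right a b b' c)
  then have "c \<in> carrier F" using effect_algebra.oplus_closed[OF assms(2)] by blast
  then show ?case using right by simp
qed simp_all

locale tensor_pair = E: effect_algebra E + F: effect_algebra F
  for E :: "'a ea" and F :: "'b ea"
begin

abbreviation cong (infix \<open>\<sim>\<close> 50) where "x \<sim> y \<equiv> tcong E F x y"
abbreviation cls where "cls \<equiv> tclass E F"
abbreviation "u \<equiv> {#(\<one>\<^bsub>E\<^esub>, \<one>\<^bsub>F\<^esub>)#}"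
abbreviation "ok x \<equiv> set_mset x \<subseteq> carrier E \<times> carrier F"

lemma cong_ok: "x \<sim> y \<Longrightarrow> ok x \<and> ok y"
  using tcong_set E.effect_algebra_axioms F.effect_algebra_axioms by blast

lemma cls_eq_iff: "ok x \<or> ok y \<Longrightarrow> cls x = cls y \<longleftrightarrow> x \<sim> y"
proof
  assume o: "ok x \<or> ok y" and "cls x = cls y"
  then have "x \<sim> z \<longleftrightarrow> y \<sim> z" for z by (auto simp: tclass_def)
  then show "x \<sim> y" using o tcong.refl[of x E F] tcong.refl[of y E F] tcong.sym by blast
next
  assume "x \<sim> y"
  then have "x \<sim> z \<longleftrightarrow> y \<sim> z" for z using tcong.trans tcong.sym by blast
  then show "cls x = cls y" by (simp add: tclass_def)
qed

lemma cong_add2: "x \<sim> x' \<Longrightarrow> y \<sim> y' \<Longrightarrow> x + y \<sim> x' + y'"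
  using tcong.add[of E F x x' y] tcong.add[of E F y y' x'] cong_ok[of x x'] cong_ok[of y y']
    tcong.trans[of E F "x + y" "x' + y" "x' + y'"] by (simp add: add.commute)

lemma u_ok: "ok u" using E.one_closed F.one_closed by auto

definition below where "below x \<longleftrightarrow> (\<exists>y. x + y \<sim> u)"

lemma below_ok: "below x \<Longrightarrow> ok x"
  unfolding below_def using cong_ok by fastforce

lemma below_cong: "x \<sim> y \<Longrightarrow> below x \<longleftrightarrow> below y"
proof -
  have "below y" if xy: "x \<sim> y" and "below x" for x y
  proof -
    obtain z where z: "x + z \<sim> u" using \<open>below x\<close> below_def by auto
    then have "ok z" using cong_ok[OF z] by simp
    then have "y + z \<sim> x + z" using tcong.add tcong.sym xy by metis
    then show ?thesis unfolding below_def using z tcong.trans by metis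
  qed
  then show "x \<sim> y \<Longrightarrow> below x \<longleftrightarrow> below y" using tcong.sym by blast
qed

lemma below_sub: "below (x + y) \<Longrightarrow> below x"
  unfolding below_def by (metis add.assoc)

lemma carrier_iff: "X \<in> carrier (E \<otimes> F) \<longleftrightarrow> (\<exists>x. below x \<and> X = cls x)"
  unfolding tensor_def tcarrier_def below_def by auto

lemma cls_in_iff: "ok x \<Longrightarrow> cls x \<in> tcarrier E F \<longleftrightarrow> below x"
  unfolding tcarrier_def using cls_eq_iff below_cong below_def by auto

lemma oplus_cls: assumes "ok x" "ok y"
  shows "cls x \<oplus>\<^bsub>E \<otimes> F\<^esub> cls y = (if below (x + y) then Some (cls (x + y)) else None)"
proof -
  have "{z. \<exists>x'\<in>cls x. \<exists>y'\<in>cls y. x' + y' \<sim> z} = cls (x + y)"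
    unfolding tclass_def using assms
    using tcong.refl[of x E F] tcong.refl[of y E F] cong_add2 tcong.trans by fast
  then show ?thesis using cls_in_iff[of "x + y"] assms by (simp add: tensor_def)
qed

lemma zero_tensor: "\<zero>\<^bsub>E \<otimes> F\<^esub> = cls {#}" and one_tensor: "\<one>\<^bsub>E \<otimes> F\<^esub> = cls u"
  by (simp_all add: tensor_def)

lemma below_u: "below u"
  unfolding below_def using tcong.refl[OF u_ok] by (metis add.right_neutral)

lemma below_zero: "below {#}"
  using below_sub[of "{#}" u] below_u by simp

theorem effect_algebra_tensor: "effect_algebra (E \<otimes> F)"
proof
  show "\<zero>\<^bsub>E \<otimes> F\<^esub> \<in> carrier (E \<otimes> F)" "\<one>\<^bsub>E \<otimes> F\<^esub> \<in> carrier (E \<otimes> F)"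
    using below_zero below_u carrier_iff zero_tensor one_tensor by auto
next
  fix a b c assume "a \<in> carrier (E \<otimes> F)" "b \<in> carrier (E \<otimes> F)" and sum: "a \<oplus>\<^bsub>E \<otimes> F\<^esub> b = Some c"
  then obtain x y where "below x" "below y" "a = cls x" "b = cls y" using carrier_iff by auto
  then show "c \<in> carrier (E \<otimes> F)"
    using sum by (auto simp: oplus_cls below_ok carrier_iff split: if_splits)
next
  fix a b assume "a \<in> carrier (E \<otimes> F)" "b \<in> carrier (E \<otimes> F)"
  then obtain x y where "below x" "below y" "a = cls x" "b = cls y" using carrier_iff by auto
  then show "a \<oplus>\<^bsub>E \<otimes> F\<^esub> b = b \<oplus>\<^bsub>E \<otimes> F\<^esub> a"
    by (simp add: oplus_cls below_ok add.commute)
next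
  fix a b c
  assume "a \<in> carrier (E \<otimes> F)" "b \<in> carrier (E \<otimes> F)" "c \<in> carrier (E \<otimes> F)"
  then obtain x y z where xyz: "below x" "below y" "below z" "a = cls x" "b = cls y" "c = cls z"
    using carrier_iff by auto
  have "below (x + y)" "below (y + z)" if "below (x + y + z)"
    using that below_sub[of "x + y" z] below_sub[of "y + z" x] by (simp_all add: ac_simps)
  then show "Option.bind (a \<oplus>\<^bsub>E \<otimes> F\<^esub> b) (\<lambda>x. x \<oplus>\<^bsub>E \<otimes> F\<^esub> c) =
    Option.bind (b \<oplus>\<^bsub>E \<otimes> F\<^esub> c) (\<lambda>x. a \<oplus>\<^bsub>E \<otimes> F\<^esub> x)"
    using xyz below_ok by (auto simp: oplus_cls add.assoc split: bind_split)
next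
  fix a assume "a \<in> carrier (E \<otimes> F)"
  then obtain x where x: "below x" "a = cls x" using carrier_iff by auto
  then show "\<zero>\<^bsub>E \<otimes> F\<^esub> \<oplus>\<^bsub>E \<otimes> F\<^esub> a = Some a"
    by (simp add: zero_tensor oplus_cls below_ok)
  obtain y where y: "x + y \<sim> u" using x below_def by auto
  have by': "below y" using y below_sub[of y x] below_u below_cong by (metis add.commute)
  show "\<exists>!b. b \<in> carrier (E \<otimes> F) \<and> a \<oplus>\<^bsub>E \<otimes> F\<^esub> b = Some \<one>\<^bsub>E \<otimes> F\<^esub>"
  proof (rule ex1I[of _ "cls y"])
    show "cls y \<in> carrier (E \<otimes> F) \<and> a \<oplus>\<^bsub>E \<otimes> F\<^esub> cls y = Some \<one>\<^bsub>E \<otimes> F\<^esub>"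
    proof
      show "cls y \<in> carrier (E \<otimes> F)" using by' carrier_iff by blast
      have "cls (x + y) = cls u" using y cls_eq_iff u_ok by blast
      then show "a \<oplus>\<^bsub>E \<otimes> F\<^esub> cls y = Some \<one>\<^bsub>E \<otimes> F\<^esub>"
        using x by' below_cong[OF y] below_u by (simp add: one_tensor oplus_cls below_ok)
    qed
    fix b assume b: "b \<in> carrier (E \<otimes> F) \<and> a \<oplus>\<^bsub>E \<otimes> F\<^esub> b = Some \<one>\<^bsub>E \<otimes> F\<^esub>"
    then obtain z where z: "below z" "b = cls z" using carrier_iff by auto
    then have "cls (x + z) = cls u" using b x
      by (auto simp: one_tensor oplus_cls below_ok split: if_splits)
    then have "x + z \<sim> u" using cls_eq_iff u_ok by blast
    then show "b = cls y" using y z tcong.ortho cls_eq_iff by'[THEN below_ok] by blast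
  qed
  assume "a \<oplus>\<^bsub>E \<otimes> F\<^esub> \<one>\<^bsub>E \<otimes> F\<^esub> \<noteq> None"
  then have "below (x + u)" using x u_ok by (auto simp: one_tensor oplus_cls below_ok split: if_splits)
  then obtain y where "u + (x + y) \<sim> u" unfolding below_def by (metis add.assoc add.commute)
  moreover have "u + {#} \<sim> u" using tcong.refl[OF u_ok] by simp
  ultimately have "x + y \<sim> {#}" by (rule tcong.ortho)
  then have "x \<sim> {#}" by (rule tcong.positive)
  then show "a = \<zero>\<^bsub>E \<otimes> F\<^esub>" using x zero_tensor cls_eq_iff by simp
qed

lemma below_pure: assumes "a \<in> carrier E" "b \<in> carrier F" shows "below {#(a, b)#}"
proof -
  obtain a' where a': "a' \<in> carrier E" "a \<oplus>\<^bsub>E\<^esub> a' = Some \<one>\<^bsub>E\<^esub>" using E.orthocomplement assms by blast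
  obtain b' where b': "b' \<in> carrier F" "b \<oplus>\<^bsub>F\<^esub> b' = Some \<one>\<^bsub>F\<^esub>" using F.orthocomplement assms by blast
  have 1: "{#(a, b), (a', b)#} \<sim> {#(\<one>\<^bsub>E\<^esub>, b)#}" using a' assms by (intro tcong.left) auto
  have 2: "{#(\<one>\<^bsub>E\<^esub>, b), (\<one>\<^bsub>E\<^esub>, b')#} \<sim> u" using b' assms E.one_closed by (intro tcong.right) auto
  have "below {#(\<one>\<^bsub>E\<^esub>, b)#}"
    using below_sub[of "{#(\<one>\<^bsub>E\<^esub>, b)#}" "{#(\<one>\<^bsub>E\<^esub>, b')#}"] below_cong[OF 2] below_u
    by (simp add: add_mset_commute)
  then have "below {#(a, b), (a', b)#}" using below_cong[OF 1] by simp
  then show ?thesis using below_sub[of "{#(a, b)#}" "{#(a', b)#}"] by (simp add: add_mset_commute)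
qed

lemma pure_biadditive: "biadditive E F (E \<otimes> F) (pure E F)"
  unfolding biadditive_def pure_def
proof (intro conjI ballI allI impI)
  fix a b assume "a \<in> carrier E" "b \<in> carrier F"
  then show "cls {#(a, b)#} \<in> carrier (E \<otimes> F)" using below_pure carrier_iff by auto
next
  fix a a' b c assume *: "a \<in> carrier E" "a' \<in> carrier E" "b \<in> carrier F" "a \<oplus>\<^bsub>E\<^esub> a' = Some c"
  then have r: "{#(a, b)#} + {#(a', b)#} \<sim> {#(c, b)#}"
    using tcong.left[of a E a' b F c] by (simp add: add_mset_commute)
  have "below ({#(a, b)#} + {#(a', b)#})"
    using below_cong[OF r] below_pure[OF E.oplus_closed[OF *(1,2,4)] *(3)] by simp
  moreover have "cls ({#(a, b)#} + {#(a', b)#}) = cls {#(c, b)#}"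
    using cls_eq_iff cong_ok[OF r] r by blast
  ultimately show "cls {#(a, b)#} \<oplus>\<^bsub>E \<otimes> F\<^esub> cls {#(a', b)#} = Some (cls {#(c, b)#})"
    using * oplus_cls[of "{#(a, b)#}" "{#(a', b)#}"] by simp
next
  fix a b b' c assume *: "a \<in> carrier E" "b \<in> carrier F" "b' \<in> carrier F" "b \<oplus>\<^bsub>F\<^esub> b' = Some c"
  then have r: "{#(a, b)#} + {#(a, b')#} \<sim> {#(a, c)#}"
    using tcong.right[of a E b F b' c] by (simp add: add_mset_commute)
  have "below ({#(a, b)#} + {#(a, b')#})"
    using below_cong[OF r] below_pure[OF *(1) F.oplus_closed[OF *(2,3,4)]] by simp
  moreover have "cls ({#(a, b)#} + {#(a, b')#}) = cls {#(a, c)#}"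
    using cls_eq_iff cong_ok[OF r] r by blast
  ultimately show "cls {#(a, b)#} \<oplus>\<^bsub>E \<otimes> F\<^esub> cls {#(a, b')#} = Some (cls {#(a, c)#})"
    using * oplus_cls[of "{#(a, b)#}" "{#(a, b')#}"] by simp
qed

theorem pure_bimorphism: "bimorphism E F (E \<otimes> F) (pure E F)"
  unfolding bimorphism_def using pure_biadditive by (simp add: pure_def one_tensor)

lemma tensor_induct [consumes 1, case_names zero add]:
  assumes "X \<in> carrier (E \<otimes> F)"
    and "P \<zero>\<^bsub>E \<otimes> F\<^esub>"
    and step: "\<And>a b X Y. \<lbrakk>a \<in> carrier E; b \<in> carrier F; X \<in> carrier (E \<otimes> F); P X;
      pure E F a b \<oplus>\<^bsub>E \<otimes> F\<^esub> X = Some Y\<rbrakk> \<Longrightarrow> P Y"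
  shows "P X"
proof -
  obtain x where "below x" "X = cls x" using assms(1) carrier_iff by auto
  moreover have "below x \<Longrightarrow> P (cls x)"
  proof (induction x)
    case empty then show ?case using assms(2) zero_tensor by simp
  next
    case (add p x)
    obtain a b where p: "p = (a, b)" by force
    have bx: "below x" using add.prems below_sub[of x "{#p#}"] by simp
    have o: "ok {#p#}" "ok x" using below_ok[OF add.prems] by auto
    have "pure E F a b \<oplus>\<^bsub>E \<otimes> F\<^esub> cls x = Some (cls (add_mset p x))"
      using oplus_cls[OF o] add.prems p by (simp add: pure_def)
    moreover have "cls x \<in> carrier (E \<otimes> F)" using bx carrier_iff by blast
    moreover have "a \<in> carrier E" "b \<in> carrier F" using o p by auto
    ultimately show ?case using step[of a b "cls x"] add.IH[OF bx] p by simp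
  qed
  ultimately show ?thesis by simp
qed

end

definition ea_additive :: "'a ea \<Rightarrow> 'b ea \<Rightarrow> ('a \<Rightarrow> 'b) \<Rightarrow> bool" where
  "ea_additive E F f \<longleftrightarrow> f \<in> carrier E \<rightarrow> carrier F \<and>
     (\<forall>a\<in>carrier E. \<forall>b\<in>carrier E. \<forall>c. a \<oplus>\<^bsub>E\<^esub> b = Some c \<longrightarrow> f a \<oplus>\<^bsub>F\<^esub> f b = Some (f c))"

lemma additive_zero:
  assumes "effect_algebra E" "effect_algebra G" "ea_additive E G f" shows "f \<zero>\<^bsub>E\<^esub> = \<zero>\<^bsub>G\<^esub>"
proof -
  interpret E: effect_algebra E by fact
  interpret G: effect_algebra G by fact
  have c: "f \<zero>\<^bsub>E\<^esub> \<in> carrier G" using assms(3) E.zero_closed by (auto simp: ea_additive_def)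
  have "f \<zero>\<^bsub>E\<^esub> \<oplus>\<^bsub>G\<^esub> f \<zero>\<^bsub>E\<^esub> = Some (f \<zero>\<^bsub>E\<^esub>)"
    using assms(3) E.zero_closed E.oplus_zero by (auto simp: ea_additive_def)
  then show ?thesis using G.oplus_cancel[OF c c G.zero_closed] G.oplus_zero_right c by blast
qed

locale tensor_lifting = tensor_pair E F + G: effect_algebra G
  for E :: "'a ea" and F :: "'b ea" and G :: "'c ea" +
  fixes \<beta> assumes \<beta>: "biadditive E F G \<beta>"
begin

definition good :: "'c option set" where "good = insert None (Some ` carrier G)"

definition padd :: "'c option \<Rightarrow> 'c option \<Rightarrow> 'c option" where
  "padd x y = (if x \<in> good \<and> y \<in> good then Option.bind x (\<lambda>a. Option.bind y (\<lambda>b. a \<oplus>\<^bsub>G\<^esub> b)) else None)"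

lemma padd_good: "padd x y \<in> good"
proof (cases "padd x y")
  case (Some c)
  then obtain a b where "a \<in> carrier G" "b \<in> carrier G" "a \<oplus>\<^bsub>G\<^esub> b = Some c"
    by (auto simp: padd_def good_def bind_eq_Some_conv split: if_splits)
  then have "c \<in> carrier G" using G.oplus_closed by blast
  then show ?thesis using Some by (simp add: good_def)
qed (simp add: good_def)

lemma padd_comm: "padd x y = padd y x"
  by (cases x; cases y) (auto simp: padd_def good_def G.oplus_comm)

lemma padd_None: "padd None y = None" "padd y None = None"
  by (auto simp: padd_def split: bind_split)

lemma padd_junk: "x \<notin> good \<or> y \<notin> good \<Longrightarrow> padd x y = None"
  by (auto simp: padd_def)

lemma padd_Some: "a \<in> carrier G \<Longrightarrow> b \<in> carrier G \<Longrightarrow> padd (Some a) (Some b) = a \<oplus>\<^bsub>G\<^esub> b"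
  by (auto simp: padd_def good_def)

lemma padd_assoc: "padd (padd x y) z = padd x (padd y z)"
proof (cases "x \<in> good \<and> y \<in> good \<and> z \<in> good")
  case True
  show ?thesis
  proof (cases "x = None \<or> y = None \<or> z = None")
    case False
    then obtain a b c where [simp]: "x = Some a" "y = Some b" "z = Some c"
      and [simp]: "a \<in> carrier G" "b \<in> carrier G" "c \<in> carrier G" using True by (auto simp: good_def)
    have 1: "padd (padd x y) z = Option.bind (a \<oplus>\<^bsub>G\<^esub> b) (\<lambda>x. x \<oplus>\<^bsub>G\<^esub> c)"
      using G.oplus_closed[of a b] by (cases "a \<oplus>\<^bsub>G\<^esub> b") (auto simp: padd_Some padd_None)
    have 2: "padd x (padd y z) = Option.bind (b \<oplus>\<^bsub>G\<^esub> c) (\<lambda>x. a \<oplus>\<^bsub>G\<^esub> x)"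
      using G.oplus_closed[of b c] by (cases "b \<oplus>\<^bsub>G\<^esub> c") (auto simp: padd_Some padd_None)
    show ?thesis using 1 2 G.oplus_assoc by simp
  qed (auto simp: padd_None)
qed (auto simp: padd_junk padd_None)

lemma padd_zero: "x \<in> good \<Longrightarrow> padd (Some \<zero>\<^bsub>G\<^esub>) x = x"
  by (auto simp: good_def padd_None padd_Some G.zero_closed G.oplus_zero)

definition psum :: "('a \<times> 'b) multiset \<Rightarrow> 'c option" where
  "psum x = fold_mset (\<lambda>p. padd (Some (\<beta> (fst p) (snd p)))) (Some \<zero>\<^bsub>G\<^esub>) x"

interpretation fc: comp_fun_commute "\<lambda>p. padd (Some (\<beta> (fst p) (snd p)))"
proof
  fix p q :: "'a \<times> 'b"
  have "padd a (padd b x) = padd b (padd a x)" for a b x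
    using padd_assoc[of a b x] padd_assoc[of b a x] padd_comm[of a b] by simp
  then show "padd (Some (\<beta> (fst p) (snd p))) \<circ> padd (Some (\<beta> (fst q) (snd q))) =
      padd (Some (\<beta> (fst q) (snd q))) \<circ> padd (Some (\<beta> (fst p) (snd p)))"
    by (simp add: fun_eq_iff)
qed

lemma psum_empty: "psum {#} = Some \<zero>\<^bsub>G\<^esub>" by (simp add: psum_def)
lemma psum_add_mset: "psum (add_mset p x) = padd (Some (\<beta> (fst p) (snd p))) (psum x)" by (simp add: psum_def)

lemma psum_good: "psum x \<in> good"
  by (induction x) (auto simp: psum_empty psum_add_mset padd_good, simp add: good_def G.zero_closed)

lemma psum_plus: "psum (x + y) = padd (psum x) (psum y)"
  by (induction x) (auto simp: psum_empty psum_add_mset padd_zero psum_good padd_assoc)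

lemma \<beta>_closed: "a \<in> carrier E \<Longrightarrow> b \<in> carrier F \<Longrightarrow> \<beta> a b \<in> carrier G"
  using \<beta> by (auto simp: biadditive_def)

lemma psum_single: "a \<in> carrier E \<Longrightarrow> b \<in> carrier F \<Longrightarrow> psum {#(a, b)#} = Some (\<beta> a b)"
  by (simp add: psum_add_mset psum_empty padd_Some \<beta>_closed G.zero_closed G.oplus_zero_right)

lemma padd_SomeD: assumes "padd x y = Some c" obtains a b where
  "x = Some a" "y = Some b" "a \<in> carrier G" "b \<in> carrier G" "a \<oplus>\<^bsub>G\<^esub> b = Some c"
proof -
  have "x \<in> good" "y \<in> good" "x \<noteq> None" "y \<noteq> None" using assms by (auto simp: padd_def bind_eq_Some_conv split: if_splits)
  then obtain a b where *: "x = Some a" "y = Some b" "a \<in> carrier G" "b \<in> carrier G" by (auto simp: good_def)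
  then show thesis using that[OF *] assms padd_Some by simp
qed

lemma psum_cong: "x \<sim> y \<Longrightarrow> psum x = psum y"
proof (induction rule: tcong.induct)
  case (left a a' b c)
  have "c \<in> carrier E" using left E.oplus_closed[of a a' c] by simp
  moreover have "\<beta> a b \<oplus>\<^bsub>G\<^esub> \<beta> a' b = Some (\<beta> c b)"
    using \<beta> left unfolding biadditive_def by blast
  moreover have "psum {#(a, b), (a', b)#} = padd (psum {#(a, b)#}) (psum {#(a', b)#})"
    using psum_plus[of "{#(a, b)#}" "{#(a', b)#}"] by (simp add: add_mset_commute)
  ultimately show ?case using left by (simp add: psum_single padd_Some \<beta>_closed)
next
  case (right a b b' c)
  have "c \<in> carrier F" using right F.oplus_closed[of b b' c] by simp
  moreover have "\<beta> a b \<oplus>\<^bsub>G\<^esub> \<beta> a b' = Some (\<beta> a c)"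
    using \<beta> right unfolding biadditive_def by blast
  moreover have "psum {#(a, b), (a, b')#} = padd (psum {#(a, b)#}) (psum {#(a, b')#})"
    using psum_plus[of "{#(a, b)#}" "{#(a, b')#}"] by (simp add: add_mset_commute)
  ultimately show ?case using right by (simp add: psum_single padd_Some \<beta>_closed)
next
  case (ortho x y z)
  let ?w = "\<beta> \<one>\<^bsub>E\<^esub> \<one>\<^bsub>F\<^esub>"
  have "padd (psum x) (psum y) = Some ?w" "padd (psum x) (psum z) = Some ?w"
    using ortho.IH psum_plus[of x y] psum_plus[of x z] psum_single[OF E.one_closed F.one_closed]
    by simp_all
  then obtain a b c where "psum x = Some a" "psum y = Some b" "psum z = Some c"
      "a \<in> carrier G" "b \<in> carrier G" "c \<in> carrier G"
      "a \<oplus>\<^bsub>G\<^esub> b = Some ?w" "a \<oplus>\<^bsub>G\<^esub> c = Some ?w"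
    by (auto elim!: padd_SomeD)
  then show ?case using G.oplus_cancel[of a b c] by simp
next
  case (positive x y)
  then have "padd (psum x) (psum y) = Some \<zero>\<^bsub>G\<^esub>" using psum_plus psum_empty by auto
  then show ?case by (elim padd_SomeD) (auto simp: psum_empty dest: G.oplus_eq_zero)
qed (auto simp: psum_plus)

lemma psum_below: assumes "below x" obtains c where "c \<in> carrier G" "psum x = Some c"
proof -
  obtain y where "x + y \<sim> u" using assms below_def by auto
  then have "padd (psum x) (psum y) = Some (\<beta> \<one>\<^bsub>E\<^esub> \<one>\<^bsub>F\<^esub>)"
    using psum_cong[of "x + y" u] psum_plus[of x y] psum_single[OF E.one_closed F.one_closed] by simp
  then show thesis using that by (elim padd_SomeD)
qed

definition lift where "lift X = the (psum (SOME x. X = cls x \<and> below x))"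

lemma lift_cls: assumes "below x" shows "psum x = Some (lift (cls x))"
proof -
  let ?y = "SOME y. cls x = cls y \<and> below y"
  have "cls x = cls ?y \<and> below ?y" by (rule someI[of _ x]) (use assms in simp)
  then have "x \<sim> ?y" using cls_eq_iff[of x ?y] below_ok[OF assms] by blast
  then have "psum ?y = psum x" using psum_cong by simp
  moreover obtain c where "psum x = Some c" using psum_below[OF assms] by blast
  ultimately show ?thesis by (simp add: lift_def)
qed

lemma lift_additive: "ea_additive (E \<otimes> F) G lift"
  unfolding ea_additive_def
proof (intro conjI ballI allI impI funcsetI)
  fix X assume "X \<in> carrier (E \<otimes> F)"
  then obtain x where "below x" "X = cls x" using carrier_iff by auto
  moreover from this obtain c where "c \<in> carrier G" "psum x = Some c" using psum_below by blast
  ultimately show "lift X \<in> carrier G" using lift_cls[of x] by simp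
next
  fix X Y Z assume "X \<in> carrier (E \<otimes> F)" "Y \<in> carrier (E \<otimes> F)" and sum: "X \<oplus>\<^bsub>E \<otimes> F\<^esub> Y = Some Z"
  then obtain x y where xy: "below x" "X = cls x" "below y" "Y = cls y" using carrier_iff by auto
  then have Z: "below (x + y)" "Z = cls (x + y)"
    using sum by (auto simp: oplus_cls below_ok split: if_splits)
  have "padd (Some (lift X)) (Some (lift Y)) = Some (lift Z)"
    using lift_cls[OF Z(1)] lift_cls[of x] lift_cls[of y] xy Z psum_plus by simp
  then show "lift X \<oplus>\<^bsub>G\<^esub> lift Y = Some (lift Z)" by (elim padd_SomeD) simp
qed

lemma lift_pure: "a \<in> carrier E \<Longrightarrow> b \<in> carrier F \<Longrightarrow> lift (pure E F a b) = \<beta> a b"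
  using lift_cls[of "{#(a, b)#}"] psum_single[of a b] below_pure by (simp add: pure_def)

end

lemma additive_unique:
  assumes "effect_algebra E" "effect_algebra F" "effect_algebra G"
    and "ea_additive (E \<otimes> F) G h" "ea_additive (E \<otimes> F) G k"
    and "\<And>a b. \<lbrakk>a \<in> carrier E; b \<in> carrier F\<rbrakk> \<Longrightarrow> h (pure E F a b) = k (pure E F a b)"
    and "X \<in> carrier (E \<otimes> F)"
  shows "h X = k X"
proof -
  interpret tensor_pair E F using assms by (simp add: tensor_pair_def)
  show ?thesis using assms(7)
  proof (induction rule: tensor_induct)
    case zero
    show ?case
      using additive_zero[OF effect_algebra_tensor assms(3) assms(4)]
        additive_zero[OF effect_algebra_tensor assms(3) assms(5)] by simp
  next
    case (add a b X Y)
    have p: "pure E F a b \<in> carrier (E \<otimes> F)" using pure_biadditive add by (auto simp: biadditive_def)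
    have "h (pure E F a b) \<oplus>\<^bsub>G\<^esub> h X = Some (h Y)" "k (pure E F a b) \<oplus>\<^bsub>G\<^esub> k X = Some (k Y)"
      using assms(4,5) add p unfolding ea_additive_def by blast+
    then show ?case using add assms(6) by simp
  qed
qed

theorem tensor_universal:
  assumes "effect_algebra E" "effect_algebra F" "effect_algebra G" "bimorphism E F G \<beta>"
  shows "\<exists>!h. h \<in> EAlg (E \<otimes> F) G \<and>
    (\<forall>a\<in>carrier E. \<forall>b\<in>carrier F. app h (pure E F a b) = \<beta> a b)"
proof -
  interpret tensor_lifting E F G \<beta>
    using assms by (simp add: tensor_lifting_def tensor_lifting_axioms_def tensor_pair_def bimorphism_def)
  interpret T: effect_algebra "E \<otimes> F" by (rule effect_algebra_tensor)
  define h where "h = \<lparr>Dom = E \<otimes> F, Cod = G, app = restrict lift (carrier (E \<otimes> F))\<rparr>"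
  have p: "pure E F a b \<in> carrier (E \<otimes> F)" if "a \<in> carrier E" "b \<in> carrier F" for a b
    using pure_biadditive that by (auto simp: biadditive_def)
  have "lift \<one>\<^bsub>E \<otimes> F\<^esub> = \<one>\<^bsub>G\<^esub>"
    using lift_pure[OF E.one_closed F.one_closed] pure_bimorphism assms(4) by (simp add: bimorphism_def)
  moreover have "lift \<in> carrier (E \<otimes> F) \<rightarrow> carrier G" using lift_additive by (simp add: ea_additive_def)
  moreover have "lift a \<oplus>\<^bsub>G\<^esub> lift b = Some (lift c)" "c \<in> carrier (E \<otimes> F)"
    if "a \<in> carrier (E \<otimes> F)" "b \<in> carrier (E \<otimes> F)" "a \<oplus>\<^bsub>E \<otimes> F\<^esub> b = Some c" for a b c
    using lift_additive that T.oplus_closed[OF that] unfolding ea_additive_def by blast+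
  ultimately have "h \<in> EAlg (E \<otimes> F) G"
  proof -
    assume 1: "lift \<one>\<^bsub>E \<otimes> F\<^esub> = \<one>\<^bsub>G\<^esub>" and 2: "lift \<in> carrier (E \<otimes> F) \<rightarrow> carrier G"
      and 3: "\<And>a b c. \<lbrakk>a \<in> carrier (E \<otimes> F); b \<in> carrier (E \<otimes> F); a \<oplus>\<^bsub>E \<otimes> F\<^esub> b = Some c\<rbrakk> \<Longrightarrow>
        lift a \<oplus>\<^bsub>G\<^esub> lift b = Some (lift c)"
      and 4: "\<And>a b c. \<lbrakk>a \<in> carrier (E \<otimes> F); b \<in> carrier (E \<otimes> F); a \<oplus>\<^bsub>E \<otimes> F\<^esub> b = Some c\<rbrakk> \<Longrightarrow>
        c \<in> carrier (E \<otimes> F)"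
    have "app h a \<oplus>\<^bsub>G\<^esub> app h b = Some (app h c)"
      if "a \<in> carrier (E \<otimes> F)" "b \<in> carrier (E \<otimes> F)" "a \<oplus>\<^bsub>E \<otimes> F\<^esub> b = Some c" for a b c
      unfolding h_def using 3[OF that] 4[OF that] that(1,2) by simp
    moreover have "app h \<one>\<^bsub>E \<otimes> F\<^esub> = \<one>\<^bsub>G\<^esub>" unfolding h_def using 1 T.one_closed by simp
    moreover have "app h \<in> carrier (E \<otimes> F) \<rightarrow>\<^sub>E carrier G" unfolding h_def using 2 by simp
    moreover have "Dom h = E \<otimes> F" "Cod h = G" unfolding h_def by simp_all
    ultimately show ?thesis unfolding EAlg_def by blast
  qed
  moreover have "\<forall>a\<in>carrier E. \<forall>b\<in>carrier F. app h (pure E F a b) = \<beta> a b"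
    using p lift_pure by (simp add: h_def)
  moreover have "k = k'" if k: "k \<in> EAlg (E \<otimes> F) G" "k' \<in> EAlg (E \<otimes> F) G"
     "\<forall>a\<in>carrier E. \<forall>b\<in>carrier F. app k (pure E F a b) = \<beta> a b"
     "\<forall>a\<in>carrier E. \<forall>b\<in>carrier F. app k' (pure E F a b) = \<beta> a b" for k k' :: "(_, _) ea_arrow"
  proof -
    have "ea_additive (E \<otimes> F) G (app k)" "ea_additive (E \<otimes> F) G (app k')"
      using k(1,2) unfolding EAlg_def ea_additive_def by (simp_all add: PiE_iff Pi_iff)
    then have "app k X = app k' X" if "X \<in> carrier (E \<otimes> F)" for X
      using additive_unique[OF assms(1-3), of "app k" "app k'" X] that k(3,4) by simp
    moreover have "app k \<in> carrier (E \<otimes> F) \<rightarrow>\<^sub>E carrier G" "app k' \<in> carrier (E \<otimes> F) \<rightarrow>\<^sub>E carrier G"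
      using k(1,2) by (simp_all add: EAlg_def)
    ultimately have "app k = app k'" by (intro PiE_ext)
    then show ?thesis using k(1,2) by (simp add: EAlg_def)
  qed
  ultimately show ?thesis by blast
qed

end

theory Submission
  imports Defs
begin

text \<open>
  An element of \<open>\<I> \<otimes> A\<close> is a step function with values in \<open>[0, 1]\<close> on the Stone space of \<open>A\<close>, and a
  morphism of \<open>BKer\<close> is a finitely additive Markov kernel. For \<open>c\<close> in \<open>C\<close> let \<open>restr c\<close> be the map
  \<open>\<alpha> \<otimes> x \<mapsto> \<alpha> \<otimes> (x \<and> c)\<close> on \<open>\<I> \<otimes> C\<close>, multiplication by the indicator of \<open>c\<close>, and let \<open>F\<close> and \<open>G\<close> be the
  Kleisli extensions of \<open>f\<close> and \<open>g\<close>, integration against these kernels. Evaluated on pure tensors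
  (\<open>app_graph\<close>), the hypothesis says that \<open>F (G (restr c (h1 d)))\<close> and \<open>F (G (restr c (h2 d)))\<close> agree for
  all \<open>c\<close> and \<open>d\<close>, and the conclusion says the same with \<open>F \<circ> restr b \<circ> G\<close> in place of \<open>F \<circ> G\<close>.

  The measure theoretic reason is that where \<open>h1 d > h2 d\<close> the difference is positive and has integral
  zero over every \<open>c\<close>, so it vanishes almost surely and has integral zero over every smaller event too.
  The proof carries this out without points and without subtraction. Step functions are locally constant:
  \<open>C\<close> is cut into finitely many pieces \<open>p\<close> on which \<open>h1 d\<close> is a constant \<open>\<alpha>\<close> and \<open>h2 d\<close> is a constant \<open>\<beta>\<close>
  (\<open>const_on_induct\<close>). On such a piece the hypothesis reads \<open>\<alpha> Y = \<beta> Y\<close> for \<open>Y = F (G (1 \<otimes> p))\<close>, whence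
  \<open>\<alpha> = \<beta>\<close> or \<open>Y = 0\<close> (\<open>scale_eq_zero\<close>). In the second case \<open>F (restr b (G (1 \<otimes> p)))\<close> is zero as well, being a
  summand of \<open>Y\<close>. In both cases the two sides of the conclusion agree on \<open>p\<close>, and they are sums over the
  pieces (\<open>restr_eq_of_null\<close>).

  What remains is to compute the structure maps of \<open>BKer\<close>, which are characterised by universal properties.
  Additive maps on a tensor product that agree on pure tensors are equal, so each identity is checked on
  pure tensors; the one point that needs care is that the partial sums involved are defined, and this is
  \<open>sum_of_additive\<close>.
\<close>

section \<open>Morphisms out of tensor products\<close>

lemma additive_closed: "\<lbrakk>ea_additive E F f; a \<in> carrier E\<rbrakk> \<Longrightarrow> f a \<in> carrier F"
  by (auto simp: ea_additive_def)

lemma additive_oplus: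
  "\<lbrakk>ea_additive E F f; a \<in> carrier E; b \<in> carrier E; a \<oplus>\<^bsub>E\<^esub> b = Some c\<rbrakk> \<Longrightarrow>
    f a \<oplus>\<^bsub>F\<^esub> f b = Some (f c)"
  by (auto simp: ea_additive_def)

lemma additiveI:
  assumes "\<And>a. a \<in> carrier E \<Longrightarrow> f a \<in> carrier F"
    and "\<And>a b c. \<lbrakk>a \<in> carrier E; b \<in> carrier E; a \<oplus>\<^bsub>E\<^esub> b = Some c\<rbrakk> \<Longrightarrow>
      f a \<oplus>\<^bsub>F\<^esub> f b = Some (f c)"
  shows "ea_additive E F f"
  using assms by (auto simp: ea_additive_def)

lemma additive_comp:
  "\<lbrakk>ea_additive E F f; ea_additive F G g\<rbrakk> \<Longrightarrow> ea_additive E G (\<lambda>a. g (f a))"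
  by (rule additiveI) (meson additive_closed additive_oplus)+

lemma additive_ident: "effect_algebra E \<Longrightarrow> ea_additive E E (\<lambda>a. a)"
  by (rule additiveI) auto

lemma EAlg_iff: "f \<in> EAlg E F \<longleftrightarrow> Dom f = E \<and> Cod f = F \<and> app f \<in> extensional (carrier E) \<and>
    app f \<one>\<^bsub>E\<^esub> = \<one>\<^bsub>F\<^esub> \<and> ea_additive E F (app f)"
  by (auto simp: EAlg_def ea_additive_def PiE_iff Pi_iff)

lemma EAlg_additive: "f \<in> EAlg E F \<Longrightarrow> ea_additive E F (app f)"
  and EAlg_Dom: "f \<in> EAlg E F \<Longrightarrow> Dom f = E"
  and EAlg_Cod: "f \<in> EAlg E F \<Longrightarrow> Cod f = F"
  and EAlg_one: "f \<in> EAlg E F \<Longrightarrow> app f \<one>\<^bsub>E\<^esub> = \<one>\<^bsub>F\<^esub>"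
  and EAlg_closed: "f \<in> EAlg E F \<Longrightarrow> a \<in> carrier E \<Longrightarrow> app f a \<in> carrier F"
  by (auto simp: EAlg_iff dest: additive_closed)

lemma EAlg_eqI:
  assumes "f \<in> EAlg E F" "g \<in> EAlg E F" "\<And>a. a \<in> carrier E \<Longrightarrow> app f a = app g a"
  shows "f = g"
proof -
  have "app f = app g" using assms by (intro extensionalityI[of _ "carrier E"]) (auto simp: EAlg_iff)
  then show ?thesis using assms by (simp add: EAlg_iff)
qed

definition arrow_of :: "'a ea \<Rightarrow> 'b ea \<Rightarrow> ('a \<Rightarrow> 'b) \<Rightarrow> ('a, 'b) ea_arrow" where
  "arrow_of E F h = \<lparr>Dom = E, Cod = F, app = restrict h (carrier E)\<rparr>"

lemma arrow_of_EAlg: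
  assumes "effect_algebra E" "ea_additive E F h" "h \<one>\<^bsub>E\<^esub> = \<one>\<^bsub>F\<^esub>"
  shows "arrow_of E F h \<in> EAlg E F"
proof -
  interpret effect_algebra E by fact
  have "ea_additive E F (restrict h (carrier E))"
  proof (rule additiveI)
    fix a b c assume *: "a \<in> carrier E" "b \<in> carrier E" "a \<oplus>\<^bsub>E\<^esub> b = Some c"
    show "restrict h (carrier E) a \<oplus>\<^bsub>F\<^esub> restrict h (carrier E) b = Some (restrict h (carrier E) c)"
      using * oplus_closed[OF *] additive_oplus[OF assms(2) *] by simp
  qed (simp add: additive_closed[OF assms(2)])
  then show ?thesis using assms one_closed by (simp add: EAlg_iff arrow_of_def)
qed

lemma app_arrow_of: "a \<in> carrier E \<Longrightarrow> app (arrow_of E F h) a = h a"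
  by (simp add: arrow_of_def)

lemma ea_id_EAlg: "effect_algebra E \<Longrightarrow> ea_id E \<in> EAlg E E"
  using arrow_of_EAlg[OF _ additive_ident, of E] by (simp add: ea_id_def arrow_of_def)

lemma app_ea_id: "a \<in> carrier E \<Longrightarrow> app (ea_id E) a = a"
  by (simp add: ea_id_def)

lemma app_ea_comp: "f \<in> EAlg E F \<Longrightarrow> a \<in> carrier E \<Longrightarrow> app (g \<circ>\<^sub>E f) a = app g (app f a)"
  by (simp add: ea_comp_def EAlg_iff compose_def)

lemma ea_comp_EAlg:
  assumes "effect_algebra E" "f \<in> EAlg E F" "g \<in> EAlg F G" shows "g \<circ>\<^sub>E f \<in> EAlg E G"
proof -
  have "arrow_of E G (\<lambda>a. app g (app f a)) \<in> EAlg E G"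
    using assms additive_comp[of E F "app f" G "app g"]
    by (intro arrow_of_EAlg) (simp_all add: EAlg_iff)
  moreover have "arrow_of E G (\<lambda>a. app g (app f a)) = g \<circ>\<^sub>E f"
    using assms by (simp add: arrow_of_def ea_comp_def compose_def EAlg_iff)
  ultimately show ?thesis by simp
qed

lemma biadditiveI:
  assumes "\<And>a. a \<in> carrier E \<Longrightarrow> ea_additive F G (\<beta> a)"
    and "\<And>b. b \<in> carrier F \<Longrightarrow> ea_additive E G (\<lambda>a. \<beta> a b)"
  shows "biadditive E F G \<beta>"
  using assms unfolding biadditive_def ea_additive_def by (simp add: Pi_iff)

lemma biadditive_right: "\<lbrakk>biadditive E F G \<beta>; a \<in> carrier E\<rbrakk> \<Longrightarrow> ea_additive F G (\<beta> a)"
  and biadditive_left: "\<lbrakk>biadditive E F G \<beta>; b \<in> carrier F\<rbrakk> \<Longrightarrow> ea_additive E G (\<lambda>a. \<beta> a b)"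
  unfolding biadditive_def ea_additive_def by (simp_all add: Pi_iff)

lemma biadditive_comp:
  assumes "biadditive E F G \<beta>" "ea_additive E' E f" "ea_additive F' F g" "ea_additive G H h"
  shows "biadditive E' F' H (\<lambda>a b. h (\<beta> (f a) (g b)))"
proof (rule biadditiveI)
  fix a assume "a \<in> carrier E'"
  then have "ea_additive F G (\<beta> (f a))" by (intro biadditive_right[OF assms(1)] additive_closed[OF assms(2)])
  from additive_comp[OF additive_comp[OF assms(3) this] assms(4)]
  show "ea_additive F' H (\<lambda>b. h (\<beta> (f a) (g b)))" .
next
  fix b assume "b \<in> carrier F'"
  then have "ea_additive E G (\<lambda>a. \<beta> a (g b))" by (intro biadditive_left[OF assms(1)] additive_closed[OF assms(3)])
  from additive_comp[OF additive_comp[OF assms(2) this] assms(4)]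
  show "ea_additive E' H (\<lambda>a. h (\<beta> (f a) (g b)))" .
qed

lemma one_tensor: "\<one>\<^bsub>E \<otimes> F\<^esub> = pure E F \<one>\<^bsub>E\<^esub> \<one>\<^bsub>F\<^esub>"
  by (simp add: tensor_def pure_def)

lemma tensor_effect_algebra: "\<lbrakk>effect_algebra E; effect_algebra F\<rbrakk> \<Longrightarrow> effect_algebra (E \<otimes> F)"
  by (intro tensor_pair.effect_algebra_tensor tensor_pair.intro)

lemma biadditive_pure:
  "\<lbrakk>effect_algebra E; effect_algebra F\<rbrakk> \<Longrightarrow> biadditive E F (E \<otimes> F) (pure E F)"
  by (intro tensor_pair.pure_biadditive tensor_pair.intro)

lemma pure_closed:
  "\<lbrakk>effect_algebra E; effect_algebra F; a \<in> carrier E; b \<in> carrier F\<rbrakk> \<Longrightarrow>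
    pure E F a b \<in> carrier (E \<otimes> F)"
  using biadditive_pure[of E F] by (simp add: biadditive_def)

abbreviation tensor_extend :: "'a ea \<Rightarrow> 'b ea \<Rightarrow> 'c ea \<Rightarrow> ('a \<Rightarrow> 'b \<Rightarrow> 'c) \<Rightarrow> ('a \<times> 'b) multiset set \<Rightarrow> 'c"
  where "tensor_extend \<equiv> tensor_lifting.lift"

lemma
  assumes "effect_algebra E" "effect_algebra F" "effect_algebra G" "biadditive E F G \<beta>"
  shows tensor_extend_additive: "ea_additive (E \<otimes> F) G (tensor_extend E F G \<beta>)"
    and tensor_extend_pure: "\<lbrakk>a \<in> carrier E; b \<in> carrier F\<rbrakk> \<Longrightarrow> tensor_extend E F G \<beta> (pure E F a b) = \<beta> a b"
proof -
  interpret tensor_lifting E F G \<beta>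
    using assms by (simp add: tensor_lifting_def tensor_lifting_axioms_def tensor_pair_def)
  show "ea_additive (E \<otimes> F) G (tensor_extend E F G \<beta>)" by (rule lift_additive)
  show "\<lbrakk>a \<in> carrier E; b \<in> carrier F\<rbrakk> \<Longrightarrow> tensor_extend E F G \<beta> (pure E F a b) = \<beta> a b"
    by (rule lift_pure)
qed

lemma (in effect_algebra) oplus_interchange:
  assumes "a \<in> carrier E" "b \<in> carrier E" "x \<in> carrier E" "y \<in> carrier E"
    and "a \<oplus> b = Some c" "x \<oplus> y = Some z" "c \<oplus> z = Some w" "a \<oplus> x = Some u" "b \<oplus> y = Some v"
  shows "u \<oplus> v = Some w"
proof -
  have cl: "c \<in> carrier E" "z \<in> carrier E" "v \<in> carrier E" using assms oplus_closed by blast+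
  obtain s where s: "s \<in> carrier E" "b \<oplus> z = Some s" "a \<oplus> s = Some w"
    using assocE[OF assms(1,2) cl(2) assms(5,7)] .
  have "z \<oplus> b = Some s" using s oplus_comm assms cl by simp
  then obtain t where "y \<oplus> b = Some t" "x \<oplus> t = Some s"
    using assocE[OF assms(3,4,2,6)] by blast
  then have "x \<oplus> v = Some s" using assms oplus_comm by (metis option.inject)
  then show ?thesis using oplus_assoc[OF assms(1,3) cl(3)] s(3) assms(8) by simp
qed

text \<open>
  That the sum on the left is defined is part of the claim. At \<open>pure E F a b \<oplus> X\<close> the value of \<open>l\<close> is a
  sum of four terms, two from the generator and two from \<open>X\<close>, and such a sum may be regrouped in any way.
  The lemma lets an equation between parametrised additive maps be checked on pure tensors, and so makes
  the extension of a trilinear map additive in the third argument.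
\<close>

lemma sum_of_additive:
  assumes ea: "effect_algebra E" "effect_algebra F" "effect_algebra G"
    and h: "ea_additive (E \<otimes> F) G h" and k: "ea_additive (E \<otimes> F) G k" and l: "ea_additive (E \<otimes> F) G l"
    and p: "\<And>a b. \<lbrakk>a \<in> carrier E; b \<in> carrier F\<rbrakk> \<Longrightarrow>
      h (pure E F a b) \<oplus>\<^bsub>G\<^esub> k (pure E F a b) = Some (l (pure E F a b))"
    and "X \<in> carrier (E \<otimes> F)"
  shows "h X \<oplus>\<^bsub>G\<^esub> k X = Some (l X)"
proof -
  interpret tensor_pair E F using ea by (simp add: tensor_pair_def)
  interpret G: effect_algebra G by fact
  have T: "effect_algebra (E \<otimes> F)" by (rule effect_algebra_tensor)
  show ?thesis using \<open>X \<in> carrier (E \<otimes> F)\<close>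
  proof (induction rule: tensor_induct)
    case zero
    then show ?case
      using additive_zero[OF T ea(3) h] additive_zero[OF T ea(3) k] additive_zero[OF T ea(3) l]
        G.oplus_zero[OF G.zero_closed] by simp
  next
    case (add a b X Y)
    have P: "pure E F a b \<in> carrier (E \<otimes> F)" by (rule pure_closed[OF ea(1,2) add(1,2)])
    show ?case
      by (rule G.oplus_interchange[OF _ _ _ _ p[OF add(1,2)] add(5) additive_oplus[OF l P add(3,4)]
            additive_oplus[OF h P add(3,4)] additive_oplus[OF k P add(3,4)]])
        (intro additive_closed[OF h] additive_closed[OF k] P add(3))+
  qed
qed

lemma EAlg_tensor_eqI:
  assumes ea: "effect_algebra E" "effect_algebra F" "effect_algebra G"
    and "f \<in> EAlg (E \<otimes> F) G" "g \<in> EAlg (E \<otimes> F) G"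
    and "\<And>a b. \<lbrakk>a \<in> carrier E; b \<in> carrier F\<rbrakk> \<Longrightarrow> app f (pure E F a b) = app g (pure E F a b)"
  shows "f = g"
  using assms additive_unique[OF ea, of "app f" "app g"] by (intro EAlg_eqI) (auto simp: EAlg_iff)

lemma
  assumes "effect_algebra E" "effect_algebra F" "effect_algebra G" "bimorphism E F G \<beta>"
  shows tensor_lift_EAlg: "tensor_lift E F G \<beta> \<in> EAlg (E \<otimes> F) G"
    and app_tensor_lift: "\<lbrakk>a \<in> carrier E; b \<in> carrier F\<rbrakk> \<Longrightarrow>
      app (tensor_lift E F G \<beta>) (pure E F a b) = \<beta> a b"
  using theI'[OF tensor_universal[OF assms]] unfolding tensor_lift_def by blast+

lemma
  assumes ea: "effect_algebra E" "effect_algebra F" "effect_algebra E'" "effect_algebra F'"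
    and fg: "f \<in> EAlg E E'" "g \<in> EAlg F F'"
  shows tensor_map_EAlg: "f \<otimes>\<^sub>E g \<in> EAlg (E \<otimes> F) (E' \<otimes> F')"
    and app_tensor_map: "\<lbrakk>a \<in> carrier E; b \<in> carrier F\<rbrakk> \<Longrightarrow>
      app (f \<otimes>\<^sub>E g) (pure E F a b) = pure E' F' (app f a) (app g b)"
proof -
  have T: "effect_algebra (E' \<otimes> F')" using ea by (blast intro: tensor_effect_algebra)
  have "biadditive E F (E' \<otimes> F') (\<lambda>a b. pure E' F' (app f a) (app g b))"
    using biadditive_comp[OF biadditive_pure EAlg_additive EAlg_additive additive_ident] ea fg T by blast
  then have "bimorphism E F (E' \<otimes> F') (\<lambda>a b. pure E' F' (app f a) (app g b))"
    using fg by (simp add: bimorphism_def one_tensor EAlg_one)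
  note * = tensor_lift_EAlg[OF ea(1,2) T this] app_tensor_lift[OF ea(1,2) T this]
  show "f \<otimes>\<^sub>E g \<in> EAlg (E \<otimes> F) (E' \<otimes> F')"
    "\<lbrakk>a \<in> carrier E; b \<in> carrier F\<rbrakk> \<Longrightarrow>
      app (f \<otimes>\<^sub>E g) (pure E F a b) = pure E' F' (app f a) (app g b)"
    using * fg by (simp_all add: tensor_map_def EAlg_Dom EAlg_Cod)
qed

lemma
  assumes ea: "effect_algebra E" "effect_algebra F"
  shows ea_sym_EAlg: "ea_sym E F \<in> EAlg (E \<otimes> F) (F \<otimes> E)"
    and app_ea_sym: "\<lbrakk>a \<in> carrier E; b \<in> carrier F\<rbrakk> \<Longrightarrow>
      app (ea_sym E F) (pure E F a b) = pure F E b a"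
proof -
  have T: "effect_algebra (F \<otimes> E)" using ea by (blast intro: tensor_effect_algebra)
  have "biadditive E F (F \<otimes> E) (\<lambda>a b. pure F E b a)"
    by (intro biadditiveI biadditive_left[OF biadditive_pure[OF ea(2,1)]]
        biadditive_right[OF biadditive_pure[OF ea(2,1)]])
  then have "bimorphism E F (F \<otimes> E) (\<lambda>a b. pure F E b a)" by (simp add: bimorphism_def one_tensor)
  note * = tensor_lift_EAlg[OF ea(1,2) T this] app_tensor_lift[OF ea(1,2) T this]
  show "ea_sym E F \<in> EAlg (E \<otimes> F) (F \<otimes> E)"
    "\<lbrakk>a \<in> carrier E; b \<in> carrier F\<rbrakk> \<Longrightarrow> app (ea_sym E F) (pure E F a b) = pure F E b a"
    using * by (simp_all add: ea_sym_def)
qed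

section \<open>Trilinear maps and the associativity isomorphisms\<close>

lemma EAlg_tensor_eqI_left:
  assumes ea: "effect_algebra E" "effect_algebra F" "effect_algebra G" "effect_algebra H"
    and hk: "h \<in> EAlg ((E \<otimes> F) \<otimes> G) H" "k \<in> EAlg ((E \<otimes> F) \<otimes> G) H"
    and eq: "\<And>a b c. \<lbrakk>a \<in> carrier E; b \<in> carrier F; c \<in> carrier G\<rbrakk> \<Longrightarrow>
      app h (pure (E \<otimes> F) G (pure E F a b) c) = app k (pure (E \<otimes> F) G (pure E F a b) c)"
  shows "h = k"
proof -
  have T: "effect_algebra (E \<otimes> F)" using ea by (blast intro: tensor_effect_algebra)
  have "app h (pure (E \<otimes> F) G Y c) = app k (pure (E \<otimes> F) G Y c)"
    if Y: "Y \<in> carrier (E \<otimes> F)" and c: "c \<in> carrier G" for Y c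
  proof -
    note l = biadditive_left[OF biadditive_pure[OF T ea(3)] c]
    show ?thesis
      by (rule additive_unique[OF ea(1,2,4) additive_comp[OF l EAlg_additive[OF hk(1)]] additive_comp[OF l EAlg_additive[OF hk(2)]] eq Y])
        (use c in simp_all)
  qed
  from EAlg_tensor_eqI[OF T ea(3,4) hk this] show ?thesis .
qed

lemma EAlg_tensor_eqI_right:
  assumes ea: "effect_algebra E" "effect_algebra F" "effect_algebra G" "effect_algebra H"
    and hk: "h \<in> EAlg (E \<otimes> (F \<otimes> G)) H" "k \<in> EAlg (E \<otimes> (F \<otimes> G)) H"
    and eq: "\<And>a b c. \<lbrakk>a \<in> carrier E; b \<in> carrier F; c \<in> carrier G\<rbrakk> \<Longrightarrow>
      app h (pure E (F \<otimes> G) a (pure F G b c)) = app k (pure E (F \<otimes> G) a (pure F G b c))"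
  shows "h = k"
proof -
  have T: "effect_algebra (F \<otimes> G)" using ea by (blast intro: tensor_effect_algebra)
  have "app h (pure E (F \<otimes> G) a Y) = app k (pure E (F \<otimes> G) a Y)"
    if Y: "Y \<in> carrier (F \<otimes> G)" and a: "a \<in> carrier E" for Y a
  proof -
    note r = biadditive_right[OF biadditive_pure[OF ea(1) T] a]
    show ?thesis
      by (rule additive_unique[OF ea(2,3,4) additive_comp[OF r EAlg_additive[OF hk(1)]] additive_comp[OF r EAlg_additive[OF hk(2)]] eq Y])
        (use a in simp_all)
  qed
  from EAlg_tensor_eqI[OF ea(1) T ea(4) hk this] show ?thesis .
qed

text \<open>
  For fixed \<open>c\<close> the universal property of \<open>E \<otimes> F\<close> gives an additive map, and additivity in \<open>c\<close> passes from
  pure tensors to all of \<open>E \<otimes> F\<close> by \<open>sum_of_additive\<close>; then the universal property of the outer tensor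
  product applies.
\<close>

lemma triple_universal_left:
  assumes ea: "effect_algebra E" "effect_algebra F" "effect_algebra G" "effect_algebra H"
    and lin: "\<And>c. c \<in> carrier G \<Longrightarrow> biadditive E F H (\<lambda>a b. \<tau> a b c)"
      "\<And>a b. \<lbrakk>a \<in> carrier E; b \<in> carrier F\<rbrakk> \<Longrightarrow> ea_additive G H (\<tau> a b)"
    and one: "\<tau> \<one>\<^bsub>E\<^esub> \<one>\<^bsub>F\<^esub> \<one>\<^bsub>G\<^esub> = \<one>\<^bsub>H\<^esub>"
  shows "\<exists>!h. h \<in> EAlg ((E \<otimes> F) \<otimes> G) H \<and> (\<forall>a\<in>carrier E. \<forall>b\<in>carrier F. \<forall>c\<in>carrier G.
    app h (pure (E \<otimes> F) G (pure E F a b) c) = \<tau> a b c)"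
proof (rule ex_ex1I)
  define L where "L c = tensor_extend E F H (\<lambda>a b. \<tau> a b c)" for c
  have T: "effect_algebra (E \<otimes> F)" using ea by (blast intro: tensor_effect_algebra)
  note add = tensor_extend_additive[OF ea(1,2,4) lin(1), folded L_def]
  note pure = tensor_extend_pure[OF ea(1,2,4) lin(1), folded L_def]
  have bi: "biadditive (E \<otimes> F) G H (\<lambda>X c. L c X)"
  proof (intro biadditiveI additiveI)
    fix X a b c assume "X \<in> carrier (E \<otimes> F)" and ab: "a \<in> carrier G" "b \<in> carrier G"
      "a \<oplus>\<^bsub>G\<^esub> b = Some c"
    have c: "c \<in> carrier G" by (rule effect_algebra.oplus_closed[OF ea(3) ab])
    show "L a X \<oplus>\<^bsub>H\<^esub> L b X = Some (L c X)"
      by (rule sum_of_additive[OF ea(1,2,4) add add add _ \<open>X \<in> _\<close>])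
        (use ab c additive_oplus[OF lin(2)] pure in simp_all)
  qed (rule additive_closed[OF add] additive_oplus[OF add]; assumption)+
  have "L \<one>\<^bsub>G\<^esub> \<one>\<^bsub>E \<otimes> F\<^esub> = \<one>\<^bsub>H\<^esub>" by (simp add: one_tensor pure one ea effect_algebra.one_closed)
  with bi have "bimorphism (E \<otimes> F) G H (\<lambda>X c. L c X)" by (simp add: bimorphism_def)
  note * = tensor_lift_EAlg[OF T ea(3,4) this] app_tensor_lift[OF T ea(3,4) this]
  show "\<exists>h. h \<in> EAlg ((E \<otimes> F) \<otimes> G) H \<and> (\<forall>a\<in>carrier E. \<forall>b\<in>carrier F. \<forall>c\<in>carrier G.
    app h (pure (E \<otimes> F) G (pure E F a b) c) = \<tau> a b c)"
    by (intro exI conjI ballI, rule *(1)) (simp add: *(2) pure pure_closed ea)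
next
  fix h k
  assume h: "h \<in> EAlg ((E \<otimes> F) \<otimes> G) H \<and> (\<forall>a\<in>carrier E. \<forall>b\<in>carrier F. \<forall>c\<in>carrier G.
      app h (pure (E \<otimes> F) G (pure E F a b) c) = \<tau> a b c)"
    and k: "k \<in> EAlg ((E \<otimes> F) \<otimes> G) H \<and> (\<forall>a\<in>carrier E. \<forall>b\<in>carrier F. \<forall>c\<in>carrier G.
      app k (pure (E \<otimes> F) G (pure E F a b) c) = \<tau> a b c)"
  show "h = k" by (rule EAlg_tensor_eqI_left[OF ea]) (use h k in simp_all)
qed

lemma triple_universal_right:
  assumes ea: "effect_algebra E" "effect_algebra F" "effect_algebra G" "effect_algebra H"
    and lin: "\<And>a. a \<in> carrier E \<Longrightarrow> biadditive F G H (\<tau> a)"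
      "\<And>b c. \<lbrakk>b \<in> carrier F; c \<in> carrier G\<rbrakk> \<Longrightarrow> ea_additive E H (\<lambda>a. \<tau> a b c)"
    and one: "\<tau> \<one>\<^bsub>E\<^esub> \<one>\<^bsub>F\<^esub> \<one>\<^bsub>G\<^esub> = \<one>\<^bsub>H\<^esub>"
  shows "\<exists>!h. h \<in> EAlg (E \<otimes> (F \<otimes> G)) H \<and> (\<forall>a\<in>carrier E. \<forall>b\<in>carrier F. \<forall>c\<in>carrier G.
    app h (pure E (F \<otimes> G) a (pure F G b c)) = \<tau> a b c)"
proof (rule ex_ex1I)
  define L where "L a = tensor_extend F G H (\<tau> a)" for a
  have T: "effect_algebra (F \<otimes> G)" using ea by (blast intro: tensor_effect_algebra)
  note add = tensor_extend_additive[OF ea(2,3,4) lin(1), folded L_def]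
  note pure = tensor_extend_pure[OF ea(2,3,4) lin(1), folded L_def]
  have bi: "biadditive E (F \<otimes> G) H L"
  proof (intro biadditiveI additiveI)
    fix X a b c assume "X \<in> carrier (F \<otimes> G)" and ab: "a \<in> carrier E" "b \<in> carrier E"
      "a \<oplus>\<^bsub>E\<^esub> b = Some c"
    have c: "c \<in> carrier E" by (rule effect_algebra.oplus_closed[OF ea(1) ab])
    show "L a X \<oplus>\<^bsub>H\<^esub> L b X = Some (L c X)"
      by (rule sum_of_additive[OF ea(2,3,4) add add add _ \<open>X \<in> _\<close>])
        (use ab c additive_oplus[OF lin(2)] pure in simp_all)
  qed (rule additive_closed[OF add] additive_oplus[OF add]; assumption)+
  have "L \<one>\<^bsub>E\<^esub> \<one>\<^bsub>F \<otimes> G\<^esub> = \<one>\<^bsub>H\<^esub>" by (simp add: one_tensor pure one ea effect_algebra.one_closed)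
  with bi have "bimorphism E (F \<otimes> G) H L" by (simp add: bimorphism_def)
  note * = tensor_lift_EAlg[OF ea(1) T ea(4) this] app_tensor_lift[OF ea(1) T ea(4) this]
  show "\<exists>h. h \<in> EAlg (E \<otimes> (F \<otimes> G)) H \<and> (\<forall>a\<in>carrier E. \<forall>b\<in>carrier F. \<forall>c\<in>carrier G.
    app h (pure E (F \<otimes> G) a (pure F G b c)) = \<tau> a b c)"
    by (intro exI conjI ballI, rule *(1)) (simp add: *(2) pure pure_closed ea)
next
  fix h k
  assume h: "h \<in> EAlg (E \<otimes> (F \<otimes> G)) H \<and> (\<forall>a\<in>carrier E. \<forall>b\<in>carrier F. \<forall>c\<in>carrier G.
      app h (pure E (F \<otimes> G) a (pure F G b c)) = \<tau> a b c)"
    and k: "k \<in> EAlg (E \<otimes> (F \<otimes> G)) H \<and> (\<forall>a\<in>carrier E. \<forall>b\<in>carrier F. \<forall>c\<in>carrier G.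
      app k (pure E (F \<otimes> G) a (pure F G b c)) = \<tau> a b c)"
  show "h = k" by (rule EAlg_tensor_eqI_right[OF ea]) (use h k in simp_all)
qed

lemma
  assumes ea: "effect_algebra E" "effect_algebra F" "effect_algebra G"
  shows ea_assoc_EAlg: "ea_assoc E F G \<in> EAlg ((E \<otimes> F) \<otimes> G) (E \<otimes> (F \<otimes> G))"
    and app_ea_assoc: "\<lbrakk>a \<in> carrier E; b \<in> carrier F; c \<in> carrier G\<rbrakk> \<Longrightarrow>
      app (ea_assoc E F G) (pure (E \<otimes> F) G (pure E F a b) c) = pure E (F \<otimes> G) a (pure F G b c)"
proof -
  have T: "effect_algebra (F \<otimes> G)" "effect_algebra (E \<otimes> (F \<otimes> G))"
    using ea by (blast intro: tensor_effect_algebra)+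
  have "biadditive E F (E \<otimes> (F \<otimes> G)) (\<lambda>a b. pure E (F \<otimes> G) a (pure F G b c))"
    if "c \<in> carrier G" for c
    using biadditive_comp[OF biadditive_pure[OF ea(1) T(1)] additive_ident[OF ea(1)]
      biadditive_left[OF biadditive_pure[OF ea(2,3)] that] additive_ident[OF T(2)]] .
  moreover have "ea_additive G (E \<otimes> (F \<otimes> G)) (\<lambda>c. pure E (F \<otimes> G) a (pure F G b c))"
    if "a \<in> carrier E" "b \<in> carrier F" for a b
    using additive_comp[OF biadditive_right[OF biadditive_pure[OF ea(2,3)] that(2)]
      biadditive_right[OF biadditive_pure[OF ea(1) T(1)] that(1)]] .
  ultimately have "\<exists>!h. h \<in> EAlg ((E \<otimes> F) \<otimes> G) (E \<otimes> (F \<otimes> G)) \<and>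
     (\<forall>a\<in>carrier E. \<forall>b\<in>carrier F. \<forall>c\<in>carrier G.
        app h (pure (E \<otimes> F) G (pure E F a b) c) = pure E (F \<otimes> G) a (pure F G b c))"
    by (rule triple_universal_left[OF ea T(2)]) (simp_all add: one_tensor)
  from theI'[OF this] show "ea_assoc E F G \<in> EAlg ((E \<otimes> F) \<otimes> G) (E \<otimes> (F \<otimes> G))"
    "\<lbrakk>a \<in> carrier E; b \<in> carrier F; c \<in> carrier G\<rbrakk> \<Longrightarrow>
      app (ea_assoc E F G) (pure (E \<otimes> F) G (pure E F a b) c) = pure E (F \<otimes> G) a (pure F G b c)"
    unfolding ea_assoc_def by blast+
qed

lemma
  assumes ea: "effect_algebra E" "effect_algebra F" "effect_algebra G"
  shows ea_assoc_inv_EAlg: "ea_assoc_inv E F G \<in> EAlg (E \<otimes> (F \<otimes> G)) ((E \<otimes> F) \<otimes> G)"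
    and app_ea_assoc_inv: "\<lbrakk>a \<in> carrier E; b \<in> carrier F; c \<in> carrier G\<rbrakk> \<Longrightarrow>
      app (ea_assoc_inv E F G) (pure E (F \<otimes> G) a (pure F G b c)) = pure (E \<otimes> F) G (pure E F a b) c"
proof -
  have T: "effect_algebra (E \<otimes> F)" "effect_algebra ((E \<otimes> F) \<otimes> G)"
    using ea by (blast intro: tensor_effect_algebra)+
  have "biadditive F G ((E \<otimes> F) \<otimes> G) (\<lambda>b c. pure (E \<otimes> F) G (pure E F a b) c)"
    if "a \<in> carrier E" for a
    using biadditive_comp[OF biadditive_pure[OF T(1) ea(3)]
      biadditive_right[OF biadditive_pure[OF ea(1,2)] that] additive_ident[OF ea(3)]
      additive_ident[OF T(2)]] .
  moreover have "ea_additive E ((E \<otimes> F) \<otimes> G) (\<lambda>a. pure (E \<otimes> F) G (pure E F a b) c)"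
    if "b \<in> carrier F" "c \<in> carrier G" for b c
    using additive_comp[OF biadditive_left[OF biadditive_pure[OF ea(1,2)] that(1)]
      biadditive_left[OF biadditive_pure[OF T(1) ea(3)] that(2)]] .
  ultimately have "\<exists>!h. h \<in> EAlg (E \<otimes> (F \<otimes> G)) ((E \<otimes> F) \<otimes> G) \<and>
     (\<forall>a\<in>carrier E. \<forall>b\<in>carrier F. \<forall>c\<in>carrier G.
        app h (pure E (F \<otimes> G) a (pure F G b c)) = pure (E \<otimes> F) G (pure E F a b) c)"
    by (rule triple_universal_right[OF ea T(2)]) (simp_all add: one_tensor)
  from theI'[OF this] show "ea_assoc_inv E F G \<in> EAlg (E \<otimes> (F \<otimes> G)) ((E \<otimes> F) \<otimes> G)"
    "\<lbrakk>a \<in> carrier E; b \<in> carrier F; c \<in> carrier G\<rbrakk> \<Longrightarrow>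
      app (ea_assoc_inv E F G) (pure E (F \<otimes> G) a (pure F G b c)) = pure (E \<otimes> F) G (pure E F a b) c"
    unfolding ea_assoc_inv_def by blast+
qed

section \<open>Boolean algebras as effect algebras\<close>

text \<open>
  Membership in \<open>BAlg\<close> only asserts that Boolean operations exist; here they are named.
\<close>

locale boolean_ea =
  boolean_algebra_on "carrier E" meet join compl "\<zero>\<^bsub>E\<^esub>" "\<one>\<^bsub>E\<^esub>"
  for E :: "'a ea" (structure) and meet join compl +
  assumes oplus_eq: "\<lbrakk>a \<in> carrier E; b \<in> carrier E\<rbrakk> \<Longrightarrow>
    a \<oplus> b = (if meet a b = \<zero> then Some (join a b) else None)"

lemma BAlgE:
  assumes "BAlg E" obtains meet join compl where "boolean_ea E meet join compl"
  using assms unfolding BAlg_def boolean_ea_def boolean_ea_axioms_def by blast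

context boolean_ea
begin

lemma meet_idem: "x \<in> carrier E \<Longrightarrow> meet x x = x"
  using meet_join_absorb[of x "meet x x"] join_meet_absorb[of x x] meet_closed[of x x] by simp

lemma meet_bot: "x \<in> carrier E \<Longrightarrow> meet \<zero> x = \<zero>"
  using join_meet_absorb[of \<zero> x] join_bot[of "meet \<zero> x"] join_comm[of \<zero> "meet \<zero> x"]
    meet_closed[of \<zero> x] bot_closed by simp

lemma join_eq_bot_iff:
  assumes "x \<in> carrier E" "y \<in> carrier E"
  shows "join x y = \<zero> \<longleftrightarrow> x = \<zero> \<and> y = \<zero>"
proof
  assume "join x y = \<zero>"
  then have "meet x \<zero> = x" "meet y \<zero> = y"
    using meet_join_absorb[of x y] meet_join_absorb[of y x] join_comm assms by simp_all
  then show "x = \<zero> \<and> y = \<zero>" using meet_bot meet_comm[of _ \<zero>] bot_closed assms by metis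
qed (use join_bot bot_closed in auto)

lemma join_meet_distrib:
  assumes "x \<in> carrier E" "y \<in> carrier E" "z \<in> carrier E"
  shows "meet (join x y) z = join (meet x z) (meet y z)"
  using assms meet_join_distrib[of z x y] meet_comm[of "join x y" z] meet_comm[of x z]
    meet_comm[of y z] join_closed by simp

text \<open>
  Applied twice, this gives the uniqueness of complements.
\<close>

lemma le_complement:
  assumes c: "a \<in> carrier E" "b \<in> carrier E" "b' \<in> carrier E"
    and "meet a b = \<zero>" "join a b' = \<one>"
  shows "meet b b' = b"
proof -
  have "b = meet b (join a b')" using assms meet_top by simp
  also have "\<dots> = join (meet b a) (meet b b')" using c by (simp add: meet_join_distrib)
  also have "\<dots> = meet b b'"
    using assms meet_comm[of b a] join_comm[of \<zero> "meet b b'"] join_bot meet_closed bot_closed by simp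
  finally show ?thesis ..
qed

lemma effect_algebra: "effect_algebra E"
proof
  show "\<zero> \<in> carrier E" "\<one> \<in> carrier E" by (fact bot_closed top_closed)+
next
  fix a b c assume "a \<in> carrier E" "b \<in> carrier E" "a \<oplus> b = Some c"
  then show "c \<in> carrier E" using join_closed by (auto simp: oplus_eq split: if_splits)
next
  fix a b assume "a \<in> carrier E" "b \<in> carrier E"
  then show "a \<oplus> b = b \<oplus> a" by (simp add: oplus_eq meet_comm[of a b] join_comm[of a b])
next
  fix a b c assume *: "a \<in> carrier E" "b \<in> carrier E" "c \<in> carrier E"
  \<comment> \<open>either way of bracketing is defined iff the three elements are pairwise disjoint\<close>
  then have "meet (join a b) c = \<zero> \<longleftrightarrow> meet a c = \<zero> \<and> meet b c = \<zero>"
    "meet a (join b c) = \<zero> \<longleftrightarrow> meet a b = \<zero> \<and> meet a c = \<zero>"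
    by (simp_all add: join_meet_distrib meet_join_distrib join_eq_bot_iff meet_closed)
  then show "Option.bind (a \<oplus> b) (\<lambda>x. x \<oplus> c) = Option.bind (b \<oplus> c) (\<lambda>x. a \<oplus> x)"
    using * by (simp add: oplus_eq join_closed join_assoc)
next
  fix a assume a: "a \<in> carrier E"
  then show "\<zero> \<oplus> a = Some a"
    using bot_closed join_bot join_comm[of \<zero> a] by (simp add: oplus_eq meet_bot)
  show "\<exists>!b. b \<in> carrier E \<and> a \<oplus> b = Some \<one>"
  proof (rule ex1I[of _ "compl a"])
    show "compl a \<in> carrier E \<and> a \<oplus> compl a = Some \<one>"
      using a by (simp add: oplus_eq compl_closed meet_compl join_compl)
    fix b assume "b \<in> carrier E \<and> a \<oplus> b = Some \<one>"
    then have b: "b \<in> carrier E" "meet a b = \<zero>" "join a b = \<one>"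
      using a by (auto simp: oplus_eq split: if_splits)
    have "meet b (compl a) = b" "meet (compl a) b = compl a"
      using le_complement[of a b "compl a"] le_complement[of a "compl a" b] a b
      by (simp_all add: compl_closed meet_compl join_compl)
    then show "b = compl a" using a b meet_comm[of b "compl a"] by (simp add: compl_closed)
  qed
  assume "a \<oplus> \<one> \<noteq> None"
  then show "a = \<zero>" using a by (simp add: oplus_eq meet_top top_closed split: if_splits)
qed

sublocale effect_algebra E by (rule effect_algebra)

lemma top_meet: "x \<in> carrier E \<Longrightarrow> meet \<one> x = x"
  using meet_comm[of \<one> x] meet_top top_closed by simp

lemma meet_left_commute:
  "\<lbrakk>x \<in> carrier E; y \<in> carrier E; z \<in> carrier E\<rbrakk> \<Longrightarrow> meet x (meet y z) = meet y (meet x z)"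
  using meet_assoc[of x y z] meet_assoc[of y x z] meet_comm[of x y] by simp

lemma meet_additive: assumes c: "c \<in> carrier E" shows "ea_additive E E (meet c)"
proof (rule additiveI)
  fix x y z assume xy: "x \<in> carrier E" "y \<in> carrier E" and "x \<oplus> y = Some z"
  then have *: "meet x y = \<zero>" "z = join x y" by (auto simp: oplus_eq split: if_splits)
  have "meet (meet c x) (meet c y) = meet c (meet c (meet x y))"
    using xy c by (simp add: meet_assoc meet_closed meet_left_commute)
  also have "\<dots> = \<zero>" using * c meet_bot meet_comm[of c \<zero>] bot_closed by simp
  finally show "meet c x \<oplus> meet c y = Some (meet c z)"
    using xy c * by (simp add: oplus_eq meet_closed meet_join_distrib)
qed (use c meet_closed in simp)

lemma meet_biadditive: "biadditive E E E meet"
proof (rule biadditiveI)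
  fix b assume b: "b \<in> carrier E"
  show "ea_additive E E (\<lambda>x. meet x b)"
  proof (rule additiveI)
    fix x y z assume *: "x \<in> carrier E" "y \<in> carrier E" "x \<oplus> y = Some z"
    show "meet x b \<oplus> meet y b = Some (meet z b)"
      using additive_oplus[OF meet_additive[OF b] *] * b oplus_closed[OF *]
      by (simp add: meet_comm[of _ b])
  qed (use b meet_closed in simp)
qed (rule meet_additive)

lemma meet_compl_split:
  assumes "x \<in> carrier E" "c \<in> carrier E"
  shows "meet x c \<oplus> meet x (compl c) = Some x"
proof -
  have "c \<oplus> compl c = Some \<one>" using assms by (simp add: oplus_eq compl_closed meet_compl join_compl)
  from additive_oplus[OF meet_additive _ _ this] show ?thesis
    using assms by (simp add: meet_top compl_closed)
qed

text \<open>
  The hypotheses place \<open>x\<close> below \<open>b\<close> and the remainder \<open>x'\<close> of \<open>a\<close> below the complement of \<open>b\<close>, so intersecting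
  \<open>a\<close> with \<open>b\<close> leaves exactly \<open>x\<close>. They are met by the values \<open>x\<close>, \<open>x'\<close>, \<open>y\<close>, \<open>z\<close> of a candidate codiagonal on
  \<open>a \<otimes> b\<close>, \<open>a \<otimes> compl b\<close>, \<open>compl a \<otimes> b\<close> and \<open>compl a \<otimes> compl b\<close>.
\<close>

lemma meet_eqI:
  assumes c: "a \<in> carrier E" "b \<in> carrier E" "x \<in> carrier E" "x' \<in> carrier E" "y \<in> carrier E"
    and "x \<oplus> x' = Some a" "x \<oplus> y = Some b" "x' \<oplus> z = Some (compl b)" "z \<in> carrier E"
  shows "x = meet a b"
proof -
  have *: "a = join x x'" "b = join x y" "compl b = join x' z"
    using assms by (auto simp: oplus_eq split: if_splits)
  have "meet x b = x" using * meet_join_absorb c by simp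
  moreover have "meet x' b = \<zero>"
  proof -
    have "meet x' (compl b) = x'" using * meet_join_absorb assms by simp
    then have "meet x' b = meet (meet x' (compl b)) b" by simp
    also have "\<dots> = meet x' \<zero>"
      using c by (simp add: meet_assoc compl_closed meet_comm[of "compl b" b] meet_compl)
    finally show ?thesis using c meet_bot meet_comm[of x' \<zero>] bot_closed by simp
  qed
  ultimately show ?thesis using * c join_meet_distrib[of x x' b] join_bot by simp
qed

text \<open>
  The codiagonal exists because \<open>meet\<close> is a bimorphism. It is unique because its values on the two
  coprojections \<open>a \<otimes> 1\<close> and \<open>1 \<otimes> b\<close> bound its value on \<open>a \<otimes> b\<close> tightly enough to force it to be the meet.
\<close>

lemma
  shows codiagonal_EAlg: "codiagonal E \<in> EAlg (E \<otimes> E) E"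
    and app_codiagonal: "\<lbrakk>a \<in> carrier E; b \<in> carrier E\<rbrakk> \<Longrightarrow>
      app (codiagonal E) (pure E E a b) = meet a b"
proof -
  note E = effect_algebra
  have bi: "bimorphism E E E meet" using meet_biadditive by (simp add: bimorphism_def meet_top top_closed)
  note * = tensor_lift_EAlg[OF E E E bi] app_tensor_lift[OF E E E bi]
  have ex: "tensor_lift E E E meet \<in> EAlg (E \<otimes> E) E \<and> (\<forall>a\<in>carrier E.
      app (tensor_lift E E E meet) (pure E E a \<one>) = a \<and> app (tensor_lift E E E meet) (pure E E \<one> a) = a)"
    using * by (simp add: one_closed meet_top top_meet)
  have uniq: "h = tensor_lift E E E meet"
    if h: "h \<in> EAlg (E \<otimes> E) E \<and> (\<forall>a\<in>carrier E. app h (pure E E a \<one>) = a \<and> app h (pure E E \<one> a) = a)"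
    for h
  proof (rule EAlg_tensor_eqI[OF E E E _ *(1)])
    show "h \<in> EAlg (E \<otimes> E) E" using h by simp
    fix a b assume ab: "a \<in> carrier E" "b \<in> carrier E"
    then have cl: "compl a \<in> carrier E" "compl b \<in> carrier E" by (simp_all add: compl_closed)
    define \<beta> where "\<beta> x y = app h (pure E E x y)" for x y
    have beta: "biadditive E E E \<beta>"
      unfolding \<beta>_def using biadditive_comp[OF biadditive_pure[OF E E] additive_ident[OF E]
        additive_ident[OF E]] h EAlg_additive by blast
    have one: "\<beta> x \<one> = x" "\<beta> \<one> x = x" if "x \<in> carrier E" for x
      using h that by (simp_all add: \<beta>_def)
    have split: "c \<oplus> compl c = Some \<one>" if "c \<in> carrier E" for c
      using that by (simp add: oplus_eq compl_closed meet_compl join_compl)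
    note r = additive_oplus[OF biadditive_right[OF beta]]
    note l = additive_oplus[OF biadditive_left[OF beta]]
    note closed = additive_closed[OF biadditive_right[OF beta]]
    have "\<beta> a b \<oplus> \<beta> a (compl b) = Some a" using r[OF ab(1) ab(2) cl(2) split[OF ab(2)]] ab one by simp
    moreover have "\<beta> a b \<oplus> \<beta> (compl a) b = Some b"
      using l[OF ab(2) ab(1) cl(1) split[OF ab(1)]] ab one by simp
    moreover have "\<beta> a (compl b) \<oplus> \<beta> (compl a) (compl b) = Some (compl b)"
      using l[OF cl(2) ab(1) cl(1) split[OF ab(1)]] cl one by simp
    ultimately have "\<beta> a b = meet a b" using ab cl closed
      by (intro meet_eqI[of a b "\<beta> a b" "\<beta> a (compl b)" "\<beta> (compl a) b" "\<beta> (compl a) (compl b)"]) simp_all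
    then show "app h (pure E E a b) = app (tensor_lift E E E meet) (pure E E a b)"
      using *(2) ab by (simp add: \<beta>_def)
  qed
  have "codiagonal E = tensor_lift E E E meet"
    unfolding codiagonal_def by (rule the_equality, rule ex, erule uniq)
  then show "codiagonal E \<in> EAlg (E \<otimes> E) E"
    "\<lbrakk>a \<in> carrier E; b \<in> carrier E\<rbrakk> \<Longrightarrow> app (codiagonal E) (pure E E a b) = meet a b"
    using * by simp_all
qed

end

section \<open>The monad and multiplication by scalars\<close>

lemma I_ea: "effect_algebra \<I>"
proof
  show "\<exists>!b. b \<in> carrier \<I> \<and> a \<oplus>\<^bsub>\<I>\<^esub> b = Some \<one>\<^bsub>\<I>\<^esub>" if "a \<in> carrier \<I>" for a
    by (rule ex1I[of _ "1 - a"]) (use that in \<open>auto simp: unit_interval_def split: if_splits\<close>)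
qed (auto simp: unit_interval_def split: if_splits)

lemma two_effect_algebra: "effect_algebra \<two>"
proof
  show "\<exists>!b. b \<in> carrier \<two> \<and> a \<oplus>\<^bsub>\<two>\<^esub> b = Some \<one>\<^bsub>\<two>\<^esub>" for a
    by (rule ex1I[of _ "\<not> a"]) (auto simp: two_def split: if_splits)
qed (auto simp: two_def split: if_splits)

lemma unit_interval_simps:
  "a \<in> carrier \<I> \<longleftrightarrow> 0 \<le> a \<and> a \<le> 1" "\<one>\<^bsub>\<I>\<^esub> = 1" "\<zero>\<^bsub>\<I>\<^esub> = 0"
  "a \<oplus>\<^bsub>\<I>\<^esub> b = (if a + b \<le> 1 then Some (a + b) else None)"
  by (auto simp: unit_interval_def)

lemma
  shows I_unit_EAlg: "I_unit \<in> EAlg \<two> \<I>" and app_I_unit: "app I_unit True = 1"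
proof -
  let ?u = "arrow_of \<two> \<I> (\<lambda>p. if p then 1 else 0)"
  have u: "?u \<in> EAlg \<two> \<I>"
    by (rule arrow_of_EAlg[OF two_effect_algebra]) (auto simp: ea_additive_def two_def unit_interval_def)
  have "k = ?u" if k: "k \<in> EAlg \<two> \<I>" for k
  proof (rule EAlg_eqI[OF k u])
    have "app k False = 0" "app k True = 1"
      using additive_zero[OF two_effect_algebra I_ea EAlg_additive[OF k]]
        EAlg_one[OF k] by (simp_all add: two_def unit_interval_def)
    then show "app k a = app ?u a" for a by (cases a) (simp_all add: arrow_of_def two_def)
  qed
  then have eq: "I_unit = ?u" unfolding I_unit_def using u by blast
  show "I_unit \<in> EAlg \<two> \<I>" unfolding eq by (rule u)
  show "app I_unit True = 1" unfolding eq by (simp add: arrow_of_def two_def)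
qed

lemma mult_biadditive: "biadditive \<I> \<I> \<I> (*)"
proof (rule biadditiveI)
  fix a assume a: "a \<in> carrier \<I>"
  show "ea_additive \<I> \<I> ((*) a)"
  proof (rule additiveI)
    fix x y z assume "x \<in> carrier \<I>" "y \<in> carrier \<I>" "x \<oplus>\<^bsub>\<I>\<^esub> y = Some z"
    then have "0 \<le> z" "z \<le> 1" "z = x + y" by (auto simp: unit_interval_simps split: if_splits)
    then show "a * x \<oplus>\<^bsub>\<I>\<^esub> a * y = Some (a * z)"
      using a mult_le_one[of a z] by (simp add: unit_interval_simps distrib_left)
  qed (use a in \<open>simp add: unit_interval_simps mult_le_one\<close>)
  moreover have "(*) a = (\<lambda>x. x * a)" by (simp add: fun_eq_iff mult.commute)
  ultimately show "ea_additive \<I> \<I> (\<lambda>x. x * a)" by simp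
qed

lemma I_mult_EAlg: "I_mult \<in> EAlg (\<I> \<otimes> \<I>) \<I>"
  and app_I_mult: "\<lbrakk>a \<in> carrier \<I>; b \<in> carrier \<I>\<rbrakk> \<Longrightarrow> app I_mult (pure \<I> \<I> a b) = a * b"
proof -
  have "bimorphism \<I> \<I> \<I> (*)" using mult_biadditive by (simp add: bimorphism_def unit_interval_simps)
  note * = tensor_lift_EAlg[OF I_ea I_ea
      I_ea this]
    app_tensor_lift[OF I_ea I_ea
      I_ea this]
  show "I_mult \<in> EAlg (\<I> \<otimes> \<I>) \<I>"
    "\<lbrakk>a \<in> carrier \<I>; b \<in> carrier \<I>\<rbrakk> \<Longrightarrow> app I_mult (pure \<I> \<I> a b) = a * b"
    unfolding I_mult_def by (fact *)+
qed

lemma I_tensor_effect_algebra: "effect_algebra A \<Longrightarrow> effect_algebra (\<I> \<otimes> A)"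
  by (rule tensor_effect_algebra[OF I_ea])

lemma
  assumes A: "effect_algebra A"
  shows monad_unit_EAlg: "monad_unit A \<in> EAlg A (\<I> \<otimes> A)"
    and app_monad_unit: "a \<in> carrier A \<Longrightarrow> app (monad_unit A) a = pure \<I> A 1 a"
proof -
  have eq: "ea_unitor_inv A = arrow_of A (\<two> \<otimes> A) (pure \<two> A True)"
    by (simp add: ea_unitor_inv_def arrow_of_def)
  have T: "True \<in> carrier \<two>" "\<one>\<^bsub>\<two>\<^esub> = True" by (simp_all add: two_def)
  have u: "ea_unitor_inv A \<in> EAlg A (\<two> \<otimes> A)"
    unfolding eq using biadditive_right[OF biadditive_pure[OF two_effect_algebra A] T(1)]
    by (rule arrow_of_EAlg[OF A]) (simp add: one_tensor T)
  note m = tensor_map_EAlg[OF two_effect_algebra A I_ea A I_unit_EAlg ea_id_EAlg[OF A]]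
    app_tensor_map[OF two_effect_algebra A I_ea A I_unit_EAlg ea_id_EAlg[OF A]]
  show "monad_unit A \<in> EAlg A (\<I> \<otimes> A)"
    unfolding monad_unit_def by (rule ea_comp_EAlg[OF A u m(1)])
  show "app (monad_unit A) a = pure \<I> A 1 a" if a: "a \<in> carrier A"
  proof -
    have "app (ea_unitor_inv A) a = pure \<two> A True a" using a by (simp add: eq app_arrow_of)
    then show ?thesis
      using a m(2)[OF T(1) a] by (simp add: monad_unit_def app_ea_comp[OF u a] app_I_unit app_ea_id)
  qed
qed

definition scale :: "'a ea \<Rightarrow> real \<Rightarrow> 'a I_tensor \<Rightarrow> 'a I_tensor" where
  "scale A \<alpha> = tensor_extend \<I> A (\<I> \<otimes> A) (\<lambda>\<beta> a. pure \<I> A (\<alpha> * \<beta>) a)"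

lemma mult_closed: "\<lbrakk>\<alpha> \<in> carrier \<I>; \<beta> \<in> carrier \<I>\<rbrakk> \<Longrightarrow> \<alpha> * \<beta> \<in> carrier \<I>"
  by (simp add: unit_interval_simps mult_le_one)

lemma
  assumes A: "effect_algebra A" and \<alpha>: "\<alpha> \<in> carrier \<I>"
  shows scale_additive: "ea_additive (\<I> \<otimes> A) (\<I> \<otimes> A) (scale A \<alpha>)"
    and scale_pure: "\<lbrakk>\<beta> \<in> carrier \<I>; a \<in> carrier A\<rbrakk> \<Longrightarrow>
      scale A \<alpha> (pure \<I> A \<beta> a) = pure \<I> A (\<alpha> * \<beta>) a"
proof -
  have "biadditive \<I> A (\<I> \<otimes> A) (\<lambda>\<beta> a. pure \<I> A (\<alpha> * \<beta>) a)"
    using biadditive_comp[OF biadditive_pure[OF I_ea A] biadditive_right[OF mult_biadditive \<alpha>]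
      additive_ident[OF A] additive_ident[OF I_tensor_effect_algebra[OF A]]] .
  note * = tensor_extend_additive[OF I_ea A I_tensor_effect_algebra[OF A] this]
    tensor_extend_pure[OF I_ea A I_tensor_effect_algebra[OF A] this]
  show "ea_additive (\<I> \<otimes> A) (\<I> \<otimes> A) (scale A \<alpha>)"
    "\<lbrakk>\<beta> \<in> carrier \<I>; a \<in> carrier A\<rbrakk> \<Longrightarrow> scale A \<alpha> (pure \<I> A \<beta> a) = pure \<I> A (\<alpha> * \<beta>) a"
    unfolding scale_def by (fact *)+
qed

lemma scale_closed:
  "\<lbrakk>effect_algebra A; \<alpha> \<in> carrier \<I>; X \<in> carrier (\<I> \<otimes> A)\<rbrakk> \<Longrightarrow> scale A \<alpha> X \<in> carrier (\<I> \<otimes> A)"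
  using additive_closed[OF scale_additive] .

lemma scale_one:
  assumes A: "effect_algebra A" and X: "X \<in> carrier (\<I> \<otimes> A)"
  shows "scale A 1 X = X"
proof -
  have 1: "1 \<in> carrier \<I>" by (simp add: unit_interval_simps)
  show ?thesis
    by (rule additive_unique[OF I_ea A I_tensor_effect_algebra[OF A] scale_additive[OF A 1]
          additive_ident[OF I_tensor_effect_algebra[OF A]] _ X]) (simp add: scale_pure[OF A 1])
qed

lemma scale_scale:
  assumes A: "effect_algebra A" and \<alpha>: "\<alpha> \<in> carrier \<I>" and \<beta>: "\<beta> \<in> carrier \<I>"
    and X: "X \<in> carrier (\<I> \<otimes> A)"
  shows "scale A \<alpha> (scale A \<beta> X) = scale A (\<alpha> * \<beta>) X"
  by (rule additive_unique[OF I_ea A I_tensor_effect_algebra[OF A]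
        additive_comp[OF scale_additive[OF A \<beta>] scale_additive[OF A \<alpha>]]
        scale_additive[OF A mult_closed[OF \<alpha> \<beta>]] _ X])
    (simp add: scale_pure A \<alpha> \<beta> mult_closed mult.assoc)

lemma scale_add:
  assumes A: "effect_algebra A" and \<alpha>: "\<alpha> \<in> carrier \<I>" and \<beta>: "\<beta> \<in> carrier \<I>"
    and s: "\<alpha> \<oplus>\<^bsub>\<I>\<^esub> \<beta> = Some \<gamma>" and X: "X \<in> carrier (\<I> \<otimes> A)"
  shows "scale A \<alpha> X \<oplus>\<^bsub>\<I> \<otimes> A\<^esub> scale A \<beta> X = Some (scale A \<gamma> X)"
proof (rule sum_of_additive[OF I_ea A I_tensor_effect_algebra[OF A] _ _ _ _ X])
  have \<gamma>: "\<gamma> \<in> carrier \<I>" by (rule effect_algebra.oplus_closed[OF I_ea \<alpha> \<beta> s])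
  show "ea_additive (\<I> \<otimes> A) (\<I> \<otimes> A) (scale A \<alpha>)" "ea_additive (\<I> \<otimes> A) (\<I> \<otimes> A) (scale A \<beta>)"
    "ea_additive (\<I> \<otimes> A) (\<I> \<otimes> A) (scale A \<gamma>)"
    by (fact scale_additive[OF A \<alpha>] scale_additive[OF A \<beta>] scale_additive[OF A \<gamma>])+
  fix \<delta> a assume *: "\<delta> \<in> carrier \<I>" "a \<in> carrier A"
  have "\<alpha> * \<delta> \<oplus>\<^bsub>\<I>\<^esub> \<beta> * \<delta> = Some (\<gamma> * \<delta>)"
    by (rule additive_oplus[OF biadditive_left[OF mult_biadditive *(1)] \<alpha> \<beta> s])
  from additive_oplus[OF biadditive_left[OF biadditive_pure[OF I_ea A] *(2)] _ _ this]
  show "scale A \<alpha> (pure \<I> A \<delta> a) \<oplus>\<^bsub>\<I> \<otimes> A\<^esub> scale A \<beta> (pure \<I> A \<delta> a) = Some (scale A \<gamma> (pure \<I> A \<delta> a))"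
    using * by (simp add: scale_pure A \<alpha> \<beta> \<gamma> mult_closed)
qed

lemma half_inject:
  assumes A: "effect_algebra A" and X: "X \<in> carrier (\<I> \<otimes> A)" and Y: "Y \<in> carrier (\<I> \<otimes> A)"
    and eq: "scale A (1 / 2) X = scale A (1 / 2) Y"
  shows "X = Y"
proof -
  have h: "1 / 2 \<in> carrier \<I>" "1 / 2 \<oplus>\<^bsub>\<I>\<^esub> 1 / 2 = Some 1" by (simp_all add: unit_interval_simps)
  have "Some (scale A 1 X) = Some (scale A 1 Y)"
    using scale_add[OF A h(1) h(1) h(2) X] scale_add[OF A h(1) h(1) h(2) Y] by (simp only: eq)
  then show ?thesis by (simp only: scale_one[OF A X] scale_one[OF A Y] option.inject)
qed

text \<open>
  An element is the sum of its two halves, so multiplication by \<open>1 / 2\<close> is injective, hence so is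
  multiplication by each power of \<open>1 / 2\<close>. Some power of \<open>1 / 2\<close> is a multiple of \<open>\<epsilon>\<close> by a scalar in \<open>[0, 1]\<close>.
\<close>

lemma scale_inject:
  assumes A: "effect_algebra A" and X: "X \<in> carrier (\<I> \<otimes> A)" and Y: "Y \<in> carrier (\<I> \<otimes> A)"
    and \<epsilon>: "\<epsilon> \<in> carrier \<I>" "\<epsilon> > 0" and eq: "scale A \<epsilon> X = scale A \<epsilon> Y"
  shows "X = Y"
proof -
  have half: "1 / 2 \<in> carrier \<I>" by (simp add: unit_interval_simps)
  have pow: "(1 / 2) ^ n \<in> carrier \<I>" for n :: nat by (simp add: unit_interval_simps power_le_one)
  have cancel: "scale A ((1 / 2) ^ n) X = scale A ((1 / 2) ^ n) Y \<Longrightarrow> X = Y" for n :: nat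
  proof (induction n)
    case 0 then show ?case using scale_one[OF A] X Y by simp
  next
    case (Suc n)
    then have "scale A (1 / 2) (scale A ((1 / 2) ^ n) X) = scale A (1 / 2) (scale A ((1 / 2) ^ n) Y)"
      by (simp add: scale_scale[OF A half pow] X Y)
    then have "scale A ((1 / 2) ^ n) X = scale A ((1 / 2) ^ n) Y"
      by (rule half_inject[OF A scale_closed[OF A pow X] scale_closed[OF A pow Y]])
    then show ?case by (rule Suc.IH)
  qed
  obtain n where n: "(1 / 2 :: real) ^ n < \<epsilon>" using real_arch_pow_inv[OF \<epsilon>(2), of "1 / 2"] by auto
  then have "(1 / 2) ^ n / \<epsilon> \<in> carrier \<I>" using \<epsilon> by (simp add: unit_interval_simps)
  from scale_scale[OF A this \<epsilon>(1) X] scale_scale[OF A this \<epsilon>(1) Y]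
  show ?thesis using eq \<epsilon>(2) by (intro cancel[of n]) simp
qed

text \<open>
  Cancelling \<open>\<alpha> X\<close> in \<open>\<beta> X = \<alpha> X \<oplus> (\<beta> - \<alpha>) X\<close> leaves \<open>(\<beta> - \<alpha>) X = 0\<close>. This is the only place where two
  distinct constants are compared.
\<close>

lemma scale_eq_zero:
  assumes A: "effect_algebra A" and X: "X \<in> carrier (\<I> \<otimes> A)"
    and \<alpha>: "\<alpha> \<in> carrier \<I>" and \<beta>: "\<beta> \<in> carrier \<I>" and "\<alpha> < \<beta>" and eq: "scale A \<alpha> X = scale A \<beta> X"
  shows "X = \<zero>\<^bsub>\<I> \<otimes> A\<^esub>"
proof -
  interpret T: effect_algebra "\<I> \<otimes> A" by (rule I_tensor_effect_algebra[OF A])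
  have d: "\<beta> - \<alpha> \<in> carrier \<I>" "\<alpha> \<oplus>\<^bsub>\<I>\<^esub> (\<beta> - \<alpha>) = Some \<beta>"
    using \<alpha> \<beta> \<open>\<alpha> < \<beta>\<close> by (simp_all add: unit_interval_simps)
  have "scale A \<alpha> X \<oplus>\<^bsub>\<I> \<otimes> A\<^esub> scale A (\<beta> - \<alpha>) X = Some (scale A \<alpha> X)"
    using scale_add[OF A \<alpha> d(1) d(2) X] eq by simp
  moreover have "scale A \<alpha> X \<oplus>\<^bsub>\<I> \<otimes> A\<^esub> \<zero>\<^bsub>\<I> \<otimes> A\<^esub> = Some (scale A \<alpha> X)"
    by (rule T.oplus_zero_right[OF scale_closed[OF A \<alpha> X]])
  ultimately have "scale A (\<beta> - \<alpha>) X = \<zero>\<^bsub>\<I> \<otimes> A\<^esub>"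
    by (rule T.oplus_cancel[OF scale_closed[OF A \<alpha> X] scale_closed[OF A d(1) X] T.zero_closed])
  then have "scale A (\<beta> - \<alpha>) X = scale A (\<beta> - \<alpha>) \<zero>\<^bsub>\<I> \<otimes> A\<^esub>"
    using additive_zero[OF T.effect_algebra_axioms T.effect_algebra_axioms scale_additive[OF A d(1)]] by simp
  then show ?thesis using scale_inject[OF A X T.zero_closed d(1)] \<open>\<alpha> < \<beta>\<close> by simp
qed

lemma
  assumes A: "effect_algebra A"
  shows monad_mult_EAlg: "monad_mult A \<in> EAlg (\<I> \<otimes> (\<I> \<otimes> A)) (\<I> \<otimes> A)"
    and app_monad_mult: "\<lbrakk>\<alpha> \<in> carrier \<I>; X \<in> carrier (\<I> \<otimes> A)\<rbrakk> \<Longrightarrow>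
      app (monad_mult A) (pure \<I> (\<I> \<otimes> A) \<alpha> X) = scale A \<alpha> X"
proof -
  note T = I_tensor_effect_algebra[OF A]
  have II: "effect_algebra (\<I> \<otimes> \<I>)" and IT: "effect_algebra (\<I> \<otimes> (\<I> \<otimes> A))"
    by (rule I_tensor_effect_algebra[OF I_ea] I_tensor_effect_algebra[OF T])+
  note t = tensor_map_EAlg[OF II A I_ea A I_mult_EAlg ea_id_EAlg[OF A]]
    app_tensor_map[OF II A I_ea A I_mult_EAlg ea_id_EAlg[OF A]]
  note as = ea_assoc_inv_EAlg[OF I_ea I_ea A] app_ea_assoc_inv[OF I_ea I_ea A]
  show mm: "monad_mult A \<in> EAlg (\<I> \<otimes> (\<I> \<otimes> A)) (\<I> \<otimes> A)"
    unfolding monad_mult_def by (rule ea_comp_EAlg[OF IT as(1) t(1)])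
  have pure: "app (monad_mult A) (pure \<I> (\<I> \<otimes> A) \<alpha> (pure \<I> A \<beta> a)) = pure \<I> A (\<alpha> * \<beta>) a"
    if "\<alpha> \<in> carrier \<I>" "\<beta> \<in> carrier \<I>" "a \<in> carrier A" for \<alpha> \<beta> a
    using that unfolding monad_mult_def
    by (simp add: app_ea_comp[OF as(1)] as(2) t(2) pure_closed I_ea A T app_I_mult app_ea_id)
  show "app (monad_mult A) (pure \<I> (\<I> \<otimes> A) \<alpha> X) = scale A \<alpha> X"
    if \<alpha>: "\<alpha> \<in> carrier \<I>" and X: "X \<in> carrier (\<I> \<otimes> A)" for \<alpha> X
    by (rule additive_unique[OF I_ea A T additive_comp[OF biadditive_right[OF biadditive_pure[OF I_ea T] \<alpha>]
          EAlg_additive[OF mm]] scale_additive[OF A \<alpha>] _ X])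
      (simp add: pure \<alpha> scale_pure[OF A \<alpha>])
qed

section \<open>Composition and tensor of kernels\<close>

text \<open>
  On step functions this is integration against the kernel \<open>f\<close>.
\<close>

definition kleisli_ext :: "'a ea \<Rightarrow> ('b, 'a I_tensor) ea_arrow \<Rightarrow> ('b I_tensor, 'a I_tensor) ea_arrow" where
  "kleisli_ext A f = monad_mult A \<circ>\<^sub>E (ea_id \<I> \<otimes>\<^sub>E f)"

lemma Arr_ker_comp: "Arr (g \<circ>\<^sub>K f) = kleisli_ext (Src f) (Arr f) \<circ>\<^sub>E Arr g"
  by (simp add: ker_comp_def kleisli_ext_def)

lemma Src_ker_comp: "Src (g \<circ>\<^sub>K f) = Src f"
  by (simp add: ker_comp_def)

lemma
  assumes A: "effect_algebra A" and B: "effect_algebra B" and f: "f \<in> EAlg B (\<I> \<otimes> A)"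
  shows kleisli_ext_EAlg: "kleisli_ext A f \<in> EAlg (\<I> \<otimes> B) (\<I> \<otimes> A)"
    and kleisli_ext_pure: "\<lbrakk>\<beta> \<in> carrier \<I>; b \<in> carrier B\<rbrakk> \<Longrightarrow>
      app (kleisli_ext A f) (pure \<I> B \<beta> b) = scale A \<beta> (app f b)"
proof -
  note TA = I_tensor_effect_algebra[OF A] and TB = I_tensor_effect_algebra[OF B]
  note t = tensor_map_EAlg[OF I_ea B I_ea TA ea_id_EAlg[OF I_ea] f]
    app_tensor_map[OF I_ea B I_ea TA ea_id_EAlg[OF I_ea] f]
  show "kleisli_ext A f \<in> EAlg (\<I> \<otimes> B) (\<I> \<otimes> A)"
    unfolding kleisli_ext_def by (rule ea_comp_EAlg[OF TB t(1) monad_mult_EAlg[OF A]])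
  show "app (kleisli_ext A f) (pure \<I> B \<beta> b) = scale A \<beta> (app f b)"
    if "\<beta> \<in> carrier \<I>" "b \<in> carrier B"
    unfolding kleisli_ext_def using that EAlg_closed[OF f that(2)]
    by (simp add: app_ea_comp[OF t(1)] pure_closed I_ea B t(2) app_ea_id app_monad_mult[OF A])
qed

lemma kleisli_ext_scale:
  assumes A: "effect_algebra A" and B: "effect_algebra B" and f: "f \<in> EAlg B (\<I> \<otimes> A)"
    and \<alpha>: "\<alpha> \<in> carrier \<I>" and X: "X \<in> carrier (\<I> \<otimes> B)"
  shows "app (kleisli_ext A f) (scale B \<alpha> X) = scale A \<alpha> (app (kleisli_ext A f) X)"
proof -
  note F = EAlg_additive[OF kleisli_ext_EAlg[OF A B f]]
  show ?thesis
    by (rule additive_unique[OF I_ea B I_tensor_effect_algebra[OF A]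
          additive_comp[OF scale_additive[OF B \<alpha>] F] additive_comp[OF F scale_additive[OF A \<alpha>]] _ X])
      (simp add: scale_pure B \<alpha> kleisli_ext_pure[OF A B f] mult_closed scale_scale[OF A] EAlg_closed[OF f])
qed

lemma
  assumes A: "effect_algebra A" and A': "effect_algebra A'"
  shows interchange_EAlg:
      "interchange A A' \<in> EAlg ((\<I> \<otimes> A) \<otimes> (\<I> \<otimes> A')) ((\<I> \<otimes> \<I>) \<otimes> (A \<otimes> A'))"
    and app_interchange: "\<lbrakk>\<alpha> \<in> carrier \<I>; a \<in> carrier A; \<beta> \<in> carrier \<I>; a' \<in> carrier A'\<rbrakk> \<Longrightarrow>
      app (interchange A A') (pure (\<I> \<otimes> A) (\<I> \<otimes> A') (pure \<I> A \<alpha> a) (pure \<I> A' \<beta> a')) =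
      pure (\<I> \<otimes> \<I>) (A \<otimes> A') (pure \<I> \<I> \<alpha> \<beta>) (pure A A' a a')"
proof -
  note T = tensor_effect_algebra
  note ea = A A' I_ea T[OF I_ea A] T[OF I_ea A'] T[OF A I_ea] T[OF A A'] T[OF I_ea T[OF A A']]
    T[OF T[OF A I_ea] A'] T[OF T[OF I_ea A] A'] T[OF A T[OF I_ea A']]
    T[OF I_ea T[OF A T[OF I_ea A']]] T[OF T[OF I_ea A] T[OF I_ea A']]
  define s where "s = ea_sym A \<I> \<otimes>\<^sub>E ea_id A'"
  note s = tensor_map_EAlg[OF T[OF A I_ea] A' T[OF I_ea A] A' ea_sym_EAlg[OF A I_ea] ea_id_EAlg[OF A'],
      folded s_def]
    app_tensor_map[OF T[OF A I_ea] A' T[OF I_ea A] A' ea_sym_EAlg[OF A I_ea] ea_id_EAlg[OF A'],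
      folded s_def]
  define m where "m = ea_assoc \<I> A A' \<circ>\<^sub>E s \<circ>\<^sub>E ea_assoc_inv A \<I> A'"
  note as = ea_assoc_EAlg[OF I_ea A A'] and asi = ea_assoc_inv_EAlg[OF A I_ea A']
  have sa: "ea_assoc \<I> A A' \<circ>\<^sub>E s \<in> EAlg ((A \<otimes> \<I>) \<otimes> A') (\<I> \<otimes> (A \<otimes> A'))"
    by (rule ea_comp_EAlg[OF _ s(1) as]) (simp add: ea)
  have m: "m \<in> EAlg (A \<otimes> (\<I> \<otimes> A')) (\<I> \<otimes> (A \<otimes> A'))"
    unfolding m_def by (rule ea_comp_EAlg[OF _ asi sa]) (simp add: ea)
  have m_pure: "app m (pure A (\<I> \<otimes> A') a (pure \<I> A' \<beta> a')) = pure \<I> (A \<otimes> A') \<beta> (pure A A' a a')"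
    if "a \<in> carrier A" "\<beta> \<in> carrier \<I>" "a' \<in> carrier A'" for a \<beta> a'
    using that unfolding m_def
    by (simp add: app_ea_comp[OF asi] app_ea_comp[OF s(1)] s(2) pure_closed ea app_ea_assoc
        app_ea_assoc_inv app_ea_sym app_ea_id)
  note n = tensor_map_EAlg[OF I_ea T[OF A T[OF I_ea A']] I_ea T[OF I_ea T[OF A A']]
      ea_id_EAlg[OF I_ea] m]
    app_tensor_map[OF I_ea T[OF A T[OF I_ea A']] I_ea T[OF I_ea T[OF A A']]
      ea_id_EAlg[OF I_ea] m]
  note b1 = ea_assoc_EAlg[OF I_ea A T[OF I_ea A']] and b2 = ea_assoc_inv_EAlg[OF I_ea I_ea T[OF A A']]
  have i: "interchange A A' = ea_assoc_inv \<I> \<I> (A \<otimes> A') \<circ>\<^sub>E (ea_id \<I> \<otimes>\<^sub>E m) \<circ>\<^sub>E ea_assoc \<I> A (\<I> \<otimes> A')"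
    by (simp add: interchange_def m_def s_def)
  have n2: "ea_assoc_inv \<I> \<I> (A \<otimes> A') \<circ>\<^sub>E (ea_id \<I> \<otimes>\<^sub>E m) \<in>
      EAlg (\<I> \<otimes> (A \<otimes> (\<I> \<otimes> A'))) ((\<I> \<otimes> \<I>) \<otimes> (A \<otimes> A'))"
    by (rule ea_comp_EAlg[OF _ n(1) b2]) (simp add: ea)
  show "interchange A A' \<in> EAlg ((\<I> \<otimes> A) \<otimes> (\<I> \<otimes> A')) ((\<I> \<otimes> \<I>) \<otimes> (A \<otimes> A'))"
    unfolding i by (rule ea_comp_EAlg[OF _ b1 n2]) (simp add: ea)
  show "app (interchange A A') (pure (\<I> \<otimes> A) (\<I> \<otimes> A') (pure \<I> A \<alpha> a) (pure \<I> A' \<beta> a')) =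
      pure (\<I> \<otimes> \<I>) (A \<otimes> A') (pure \<I> \<I> \<alpha> \<beta>) (pure A A' a a')"
    if "\<alpha> \<in> carrier \<I>" "a \<in> carrier A" "\<beta> \<in> carrier \<I>" "a' \<in> carrier A'"
    using that unfolding i
    by (simp add: app_ea_comp[OF b1] app_ea_comp[OF n(1)] n(2) pure_closed ea m_pure app_ea_assoc
        app_ea_assoc_inv app_ea_id)
qed

text \<open>
  This is \<open>X \<mapsto> X \<otimes> c\<close> up to reassociation, the effect of tensoring a kernel with an identity.
\<close>

definition pad :: "'a ea \<Rightarrow> 'b ea \<Rightarrow> 'b \<Rightarrow> 'a I_tensor \<Rightarrow> ('a \<times> 'b) multiset set I_tensor" where
  "pad A C c = tensor_extend \<I> A (\<I> \<otimes> (A \<otimes> C)) (\<lambda>\<alpha> a. pure \<I> (A \<otimes> C) \<alpha> (pure A C a c))"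

lemma
  assumes A: "effect_algebra A" and C: "effect_algebra C" and c: "c \<in> carrier C"
  shows pad_additive: "ea_additive (\<I> \<otimes> A) (\<I> \<otimes> (A \<otimes> C)) (pad A C c)"
    and pad_pure: "\<lbrakk>\<alpha> \<in> carrier \<I>; a \<in> carrier A\<rbrakk> \<Longrightarrow>
      pad A C c (pure \<I> A \<alpha> a) = pure \<I> (A \<otimes> C) \<alpha> (pure A C a c)"
proof -
  note AC = tensor_effect_algebra[OF A C] and T = I_tensor_effect_algebra[OF tensor_effect_algebra[OF A C]]
  have "biadditive \<I> A (\<I> \<otimes> (A \<otimes> C)) (\<lambda>\<alpha> a. pure \<I> (A \<otimes> C) \<alpha> (pure A C a c))"
    using biadditive_comp[OF biadditive_pure[OF I_ea AC] additive_ident[OF I_ea]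
      biadditive_left[OF biadditive_pure[OF A C] c] additive_ident[OF T]] .
  note * = tensor_extend_additive[OF I_ea A T this] tensor_extend_pure[OF I_ea A T this]
  show "ea_additive (\<I> \<otimes> A) (\<I> \<otimes> (A \<otimes> C)) (pad A C c)"
    "\<lbrakk>\<alpha> \<in> carrier \<I>; a \<in> carrier A\<rbrakk> \<Longrightarrow>
      pad A C c (pure \<I> A \<alpha> a) = pure \<I> (A \<otimes> C) \<alpha> (pure A C a c)"
    unfolding pad_def by (fact *)+
qed

lemma
  assumes D: "effect_algebra D" and A: "effect_algebra A" and C: "effect_algebra C"
    and h: "Src h = A" "Arr h \<in> EAlg D (\<I> \<otimes> A)"
  shows ker_tensor_id_EAlg: "Arr (h \<otimes>\<^sub>K ker_id C) \<in> EAlg (D \<otimes> C) (\<I> \<otimes> (A \<otimes> C))"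
    and app_ker_tensor_id: "\<lbrakk>d \<in> carrier D; c \<in> carrier C\<rbrakk> \<Longrightarrow>
      app (Arr (h \<otimes>\<^sub>K ker_id C)) (pure D C d c) = pad A C c (app (Arr h) d)"
proof -
  note T = tensor_effect_algebra
  note AC = T[OF A C] and IA = T[OF I_ea A] and IC = T[OF I_ea C]
  define m where "m = I_mult \<otimes>\<^sub>E ea_id (A \<otimes> C)"
  note m = tensor_map_EAlg[OF T[OF I_ea I_ea] AC I_ea AC I_mult_EAlg ea_id_EAlg[OF AC], folded m_def]
    app_tensor_map[OF T[OF I_ea I_ea] AC I_ea AC I_mult_EAlg ea_id_EAlg[OF AC], folded m_def]
  note t = tensor_map_EAlg[OF D C IA IC h(2) monad_unit_EAlg[OF C]]
    app_tensor_map[OF D C IA IC h(2) monad_unit_EAlg[OF C]]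
  note i = interchange_EAlg[OF A C]
  have mi: "m \<circ>\<^sub>E interchange A C \<in> EAlg ((\<I> \<otimes> A) \<otimes> (\<I> \<otimes> C)) (\<I> \<otimes> (A \<otimes> C))"
    by (rule ea_comp_EAlg[OF T[OF IA IC] i m(1)])
  have eq: "Arr (h \<otimes>\<^sub>K ker_id C) = m \<circ>\<^sub>E interchange A C \<circ>\<^sub>E (Arr h \<otimes>\<^sub>E monad_unit C)"
    by (simp add: ker_tensor_def ker_id_def h(1) m_def)
  show "Arr (h \<otimes>\<^sub>K ker_id C) \<in> EAlg (D \<otimes> C) (\<I> \<otimes> (A \<otimes> C))"
    unfolding eq by (rule ea_comp_EAlg[OF T[OF D C] t(1) mi])
  have one: "1 \<in> carrier \<I>" by (simp add: unit_interval_simps)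
  show "app (Arr (h \<otimes>\<^sub>K ker_id C)) (pure D C d c) = pad A C c (app (Arr h) d)"
    if d: "d \<in> carrier D" and c: "c \<in> carrier C"
  proof -
    have c1: "pure \<I> C 1 c \<in> carrier (\<I> \<otimes> C)" by (rule pure_closed[OF I_ea C one c])
    have "app (m \<circ>\<^sub>E interchange A C) (pure (\<I> \<otimes> A) (\<I> \<otimes> C) X (pure \<I> C 1 c)) = pad A C c X"
      if X: "X \<in> carrier (\<I> \<otimes> A)" for X
    proof (rule additive_unique[OF I_ea A T[OF I_ea AC]
          additive_comp[OF biadditive_left[OF biadditive_pure[OF IA IC] c1] EAlg_additive[OF mi]]
          pad_additive[OF A C c] _ X])
      fix \<alpha> a assume *: "\<alpha> \<in> carrier \<I>" "a \<in> carrier A"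
      show "app (m \<circ>\<^sub>E interchange A C) (pure (\<I> \<otimes> A) (\<I> \<otimes> C) (pure \<I> A \<alpha> a) (pure \<I> C 1 c)) =
          pad A C c (pure \<I> A \<alpha> a)"
        using * c one
        by (simp add: app_ea_comp[OF i] pure_closed I_ea A C AC IA IC T[OF I_ea I_ea] app_interchange
            m(2) app_I_mult app_ea_id pad_pure)
    qed
    then show ?thesis
      using d c EAlg_closed[OF h(2) d]
      by (simp add: eq app_ea_comp[OF t(1)] t(2) pure_closed D C app_monad_unit[OF C])
  qed
qed

section \<open>Restriction and the copy map\<close>

context boolean_ea
begin

text \<open>
  On step functions this is multiplication by the indicator of \<open>c\<close>.
\<close>

definition restr :: "'a \<Rightarrow> 'a I_tensor \<Rightarrow> 'a I_tensor" where
  "restr c = tensor_extend \<I> E (\<I> \<otimes> E) (\<lambda>\<alpha> x. pure \<I> E \<alpha> (meet x c))"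

lemmas E_ea = effect_algebra
lemmas IE_ea = I_tensor_effect_algebra[OF effect_algebra]

lemma
  assumes c: "c \<in> carrier E"
  shows restr_additive: "ea_additive (\<I> \<otimes> E) (\<I> \<otimes> E) (restr c)"
    and restr_pure: "\<lbrakk>\<alpha> \<in> carrier \<I>; x \<in> carrier E\<rbrakk> \<Longrightarrow>
      restr c (pure \<I> E \<alpha> x) = pure \<I> E \<alpha> (meet x c)"
proof -
  have "biadditive \<I> E (\<I> \<otimes> E) (\<lambda>\<alpha> x. pure \<I> E \<alpha> (meet x c))"
    using biadditive_comp[OF biadditive_pure[OF I_ea E_ea] additive_ident[OF I_ea]
      biadditive_left[OF meet_biadditive c] additive_ident[OF IE_ea]] .
  note * = tensor_extend_additive[OF I_ea E_ea IE_ea this] tensor_extend_pure[OF I_ea E_ea IE_ea this]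
  show "ea_additive (\<I> \<otimes> E) (\<I> \<otimes> E) (restr c)"
    "\<lbrakk>\<alpha> \<in> carrier \<I>; x \<in> carrier E\<rbrakk> \<Longrightarrow> restr c (pure \<I> E \<alpha> x) = pure \<I> E \<alpha> (meet x c)"
    unfolding restr_def by (fact *)+
qed

lemma restr_closed: "\<lbrakk>c \<in> carrier E; X \<in> carrier (\<I> \<otimes> E)\<rbrakk> \<Longrightarrow> restr c X \<in> carrier (\<I> \<otimes> E)"
  using additive_closed[OF restr_additive] .

lemma restr_scale:
  assumes c: "c \<in> carrier E" and \<alpha>: "\<alpha> \<in> carrier \<I>" and X: "X \<in> carrier (\<I> \<otimes> E)"
  shows "restr c (scale E \<alpha> X) = scale E \<alpha> (restr c X)"
  by (rule additive_unique[OF I_ea E_ea IE_ea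
        additive_comp[OF scale_additive[OF E_ea \<alpha>] restr_additive[OF c]]
        additive_comp[OF restr_additive[OF c] scale_additive[OF E_ea \<alpha>]] _ X])
    (simp add: scale_pure[OF E_ea \<alpha>] restr_pure[OF c] mult_closed[OF \<alpha>] meet_closed c)

lemma restr_restr:
  assumes c: "c \<in> carrier E" and d: "d \<in> carrier E" and X: "X \<in> carrier (\<I> \<otimes> E)"
  shows "restr d (restr c X) = restr (meet c d) X"
  by (rule additive_unique[OF I_ea E_ea IE_ea
        additive_comp[OF restr_additive[OF c] restr_additive[OF d]]
        restr_additive[OF meet_closed[OF c d]] _ X])
    (simp add: restr_pure c d meet_closed meet_assoc)

lemma restr_one:
  assumes X: "X \<in> carrier (\<I> \<otimes> E)" shows "restr \<one> X = X"
  by (rule additive_unique[OF I_ea E_ea IE_ea restr_additive[OF top_closed] additive_ident[OF IE_ea] _ X])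
    (simp add: restr_pure top_closed meet_top)

lemma restr_add:
  assumes c: "c \<in> carrier E" "d \<in> carrier E" "c \<oplus> d = Some e" and X: "X \<in> carrier (\<I> \<otimes> E)"
  shows "restr c X \<oplus>\<^bsub>\<I> \<otimes> E\<^esub> restr d X = Some (restr e X)"
proof (rule sum_of_additive[OF I_ea E_ea IE_ea restr_additive[OF c(1)] restr_additive[OF c(2)] _ _ X])
  have e: "e \<in> carrier E" by (rule oplus_closed[OF c])
  then show "ea_additive (\<I> \<otimes> E) (\<I> \<otimes> E) (restr e)" by (rule restr_additive)
  fix \<alpha> x assume *: "\<alpha> \<in> carrier \<I>" "x \<in> carrier E"
  from additive_oplus[OF biadditive_right[OF biadditive_pure[OF I_ea E_ea] *(1)] _ _
      additive_oplus[OF meet_additive[OF *(2)] c]]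
  show "restr c (pure \<I> E \<alpha> x) \<oplus>\<^bsub>\<I> \<otimes> E\<^esub> restr d (pure \<I> E \<alpha> x) = Some (restr e (pure \<I> E \<alpha> x))"
    using * c e by (simp add: restr_pure meet_closed)
qed

text \<open>
  \<open>(h \<otimes> 1) \<circ> copy\<close> is the graph of \<open>h\<close>: the joint kernel of the outcome of \<open>h\<close> and of its input. The event
  \<open>(d, c)\<close> has the probability that \<open>h\<close> gives to \<open>d\<close> at inputs in \<open>c\<close>, and probability zero at other inputs.
\<close>

lemma
  assumes D: "effect_algebra D" and h: "Src h = E" "Arr h \<in> EAlg D (\<I> \<otimes> E)"
  shows graph_EAlg: "Arr ((h \<otimes>\<^sub>K ker_id E) \<circ>\<^sub>K ker_copy E) \<in> EAlg (D \<otimes> E) (\<I> \<otimes> E)"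
    and app_graph: "\<lbrakk>d \<in> carrier D; c \<in> carrier E\<rbrakk> \<Longrightarrow>
      app (Arr ((h \<otimes>\<^sub>K ker_id E) \<circ>\<^sub>K ker_copy E)) (pure D E d c) = restr c (app (Arr h) d)"
proof -
  note DE = tensor_effect_algebra[OF D E_ea] and EE = tensor_effect_algebra[OF E_ea E_ea]
  note t = ker_tensor_id_EAlg[OF D E_ea E_ea h] app_ker_tensor_id[OF D E_ea E_ea h]
  let ?copy = "monad_unit E \<circ>\<^sub>E codiagonal E"
  have copy: "?copy \<in> EAlg (E \<otimes> E) (\<I> \<otimes> E)"
    by (rule ea_comp_EAlg[OF EE codiagonal_EAlg monad_unit_EAlg[OF E_ea]])
  note k = kleisli_ext_EAlg[OF E_ea EE copy]
  have eq: "Arr ((h \<otimes>\<^sub>K ker_id E) \<circ>\<^sub>K ker_copy E) = kleisli_ext E ?copy \<circ>\<^sub>E Arr (h \<otimes>\<^sub>K ker_id E)"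
    by (simp add: Arr_ker_comp ker_copy_def)
  show "Arr ((h \<otimes>\<^sub>K ker_id E) \<circ>\<^sub>K ker_copy E) \<in> EAlg (D \<otimes> E) (\<I> \<otimes> E)"
    unfolding eq by (rule ea_comp_EAlg[OF DE t(1) k])
  have one: "1 \<in> carrier \<I>" by (simp add: unit_interval_simps)
  have "app (kleisli_ext E ?copy) (pad E E c X) = restr c X"
    if c: "c \<in> carrier E" and X: "X \<in> carrier (\<I> \<otimes> E)" for c X
    by (rule additive_unique[OF I_ea E_ea IE_ea additive_comp[OF pad_additive[OF E_ea E_ea c]
          EAlg_additive[OF k]] restr_additive[OF c] _ X])
      (simp add: pad_pure E_ea c kleisli_ext_pure[OF E_ea EE copy] pure_closed
        app_ea_comp[OF codiagonal_EAlg] app_codiagonal app_monad_unit meet_closed scale_pure one restr_pure)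
  then show "app (Arr ((h \<otimes>\<^sub>K ker_id E) \<circ>\<^sub>K ker_copy E)) (pure D E d c) = restr c (app (Arr h) d)"
    if "d \<in> carrier D" "c \<in> carrier E"
    using that EAlg_closed[OF h(2)]
    by (simp add: eq app_ea_comp[OF t(1)] t(2) pure_closed D E_ea)
qed

section \<open>Local constancy\<close>

text \<open>
  The step function \<open>X\<close> is constant on \<open>p\<close>. The factor \<open>\<epsilon>\<close> keeps the constants of a sum inside \<open>[0, 1]\<close>: if
  \<open>\<alpha> \<otimes> p\<close> and \<open>\<beta> \<otimes> p\<close> are summable with \<open>p \<noteq> 0\<close>, then \<open>\<alpha> + \<beta> \<le> 1\<close>, but the natural proof of this evaluates at an
  ultrafilter containing \<open>p\<close>. Half of the sum has the coefficient \<open>(\<alpha> + \<beta>) / 2\<close> in any case, and by \<open>scale_inject\<close>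
  nothing is lost by passing to a positive multiple.
\<close>

definition const_on :: "'a I_tensor \<Rightarrow> 'a \<Rightarrow> bool" where
  "const_on X p \<longleftrightarrow> (\<exists>\<epsilon>\<in>carrier \<I>. \<exists>\<alpha>\<in>carrier \<I>. \<epsilon> > 0 \<and> scale E \<epsilon> (restr p X) = pure \<I> E \<alpha> p)"

lemma const_on_meet:
  assumes X: "X \<in> carrier (\<I> \<otimes> E)" and p: "p \<in> carrier E" and q: "q \<in> carrier E" and "const_on X p"
  shows "const_on X (meet p q)"
proof -
  obtain \<epsilon> \<alpha> where *: "\<epsilon> \<in> carrier \<I>" "\<alpha> \<in> carrier \<I>" "\<epsilon> > 0" "scale E \<epsilon> (restr p X) = pure \<I> E \<alpha> p"
    using \<open>const_on X p\<close> by (auto simp: const_on_def)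
  have "scale E \<epsilon> (restr (meet p q) X) = restr q (scale E \<epsilon> (restr p X))"
    by (simp only: restr_restr[OF p q X] restr_scale[OF q *(1) restr_closed[OF p X]])
  also have "\<dots> = pure \<I> E \<alpha> (meet p q)" using * p q by (simp add: restr_pure)
  finally show ?thesis using * by (auto simp: const_on_def)
qed

lemma pure_zero: "\<alpha> \<in> carrier \<I> \<Longrightarrow> pure \<I> E \<alpha> \<zero> = \<zero>\<^bsub>\<I> \<otimes> E\<^esub>"
  by (rule additive_zero[OF E_ea IE_ea biadditive_right[OF biadditive_pure[OF I_ea E_ea]]])

lemma zero_pure: "p \<in> carrier E \<Longrightarrow> pure \<I> E 0 p = \<zero>\<^bsub>\<I> \<otimes> E\<^esub>"
  using additive_zero[OF I_ea IE_ea biadditive_left[OF biadditive_pure[OF I_ea E_ea]]]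
  by (simp add: unit_interval_simps)

lemma const_on_add:
  assumes X: "X \<in> carrier (\<I> \<otimes> E)" and \<alpha>: "\<alpha> \<in> carrier \<I>" and c: "c \<in> carrier E" and q: "q \<in> carrier E"
    and Y: "pure \<I> E \<alpha> c \<oplus>\<^bsub>\<I> \<otimes> E\<^esub> X = Some Y"
    and "const_on X q" and cq: "meet c q = q \<or> meet c q = \<zero>"
  shows "const_on Y q"
proof -
  interpret T: effect_algebra "\<I> \<otimes> E" by (rule IE_ea)
  obtain \<epsilon> \<beta> where *: "\<epsilon> \<in> carrier \<I>" "\<beta> \<in> carrier \<I>" "\<epsilon> > 0" "scale E \<epsilon> (restr q X) = pure \<I> E \<beta> q"
    using \<open>const_on X q\<close> by (auto simp: const_on_def)
  have P: "pure \<I> E \<alpha> c \<in> carrier (\<I> \<otimes> E)" by (rule pure_closed[OF I_ea E_ea \<alpha> c])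
  have Yc: "Y \<in> carrier (\<I> \<otimes> E)" by (rule T.oplus_closed[OF P X Y])
  have sum: "pure \<I> E (\<epsilon> * \<alpha>) (meet c q) \<oplus>\<^bsub>\<I> \<otimes> E\<^esub> pure \<I> E \<beta> q = Some (scale E \<epsilon> (restr q Y))"
    using additive_oplus[OF additive_comp[OF restr_additive[OF q] scale_additive[OF E_ea *(1)]] P X Y] *
    by (simp add: restr_pure q \<alpha> c scale_pure E_ea meet_closed)
  have m: "\<epsilon> * \<alpha> \<in> carrier \<I>" by (rule mult_closed[OF *(1) \<alpha>])
  show ?thesis
    using cq
  proof
    assume cq: "meet c q = q"
    have half: "1 / 2 \<in> carrier \<I>" by (simp add: unit_interval_simps)
    have s: "1 / 2 * (\<epsilon> * \<alpha>) \<oplus>\<^bsub>\<I>\<^esub> 1 / 2 * \<beta> = Some (1 / 2 * (\<epsilon> * \<alpha>) + 1 / 2 * \<beta>)"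
      using m *(2) by (simp add: unit_interval_simps)
    note mh = mult_closed[OF half m] mult_closed[OF half *(2)]
    have "pure \<I> E (1 / 2 * (\<epsilon> * \<alpha>)) q \<oplus>\<^bsub>\<I> \<otimes> E\<^esub> pure \<I> E (1 / 2 * \<beta>) q =
        Some (scale E (1 / 2) (scale E \<epsilon> (restr q Y)))"
      using additive_oplus[OF scale_additive[OF E_ea half] _ _ sum] *(2) m q
      by (simp only: cq scale_pure[OF E_ea half] pure_closed[OF I_ea E_ea])
    moreover have "pure \<I> E (1 / 2 * (\<epsilon> * \<alpha>)) q \<oplus>\<^bsub>\<I> \<otimes> E\<^esub> pure \<I> E (1 / 2 * \<beta>) q =
        Some (pure \<I> E (1 / 2 * (\<epsilon> * \<alpha>) + 1 / 2 * \<beta>) q)"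
      by (rule additive_oplus[OF biadditive_left[OF biadditive_pure[OF I_ea E_ea] q] mh s])
    ultimately have "scale E (1 / 2 * \<epsilon>) (restr q Y) = pure \<I> E (1 / 2 * (\<epsilon> * \<alpha>) + 1 / 2 * \<beta>) q"
      using scale_scale[OF E_ea half *(1) restr_closed[OF q Yc]] by simp
    then show ?thesis
      unfolding const_on_def
      using mult_closed[OF half *(1)] effect_algebra.oplus_closed[OF I_ea mh s] *(3)
      by (intro bexI[of _ "1 / 2 * \<epsilon>"] bexI[of _ "1 / 2 * (\<epsilon> * \<alpha>) + 1 / 2 * \<beta>"]) simp_all
  next
    assume "meet c q = \<zero>"
    then have "scale E \<epsilon> (restr q Y) = pure \<I> E \<beta> q"
      using sum T.oplus_zero[OF pure_closed[OF I_ea E_ea *(2) q]] by (simp add: pure_zero m)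
    then show ?thesis using * by (auto simp: const_on_def)
  qed
qed

text \<open>
  A property that is stable under disjoint joins and holds wherever \<open>X\<close> is constant holds everywhere,
  because \<open>X\<close> is a step function. The induction over \<open>X\<close> needs no explicit partition: when a term
  \<open>\<alpha> \<otimes> c\<close> is added, each piece \<open>p\<close> on which the old sum was constant is cut into \<open>p \<and> c\<close> and \<open>p \<and> compl c\<close>,
  and the new sum is constant on both.
\<close>

lemma const_on_induct:
  assumes X: "X \<in> carrier (\<I> \<otimes> E)"
    and join: "\<And>p q r. \<lbrakk>p \<in> carrier E; q \<in> carrier E; p \<oplus> q = Some r; Q p; Q q\<rbrakk> \<Longrightarrow> Q r"
    and const: "\<And>p. \<lbrakk>p \<in> carrier E; const_on X p\<rbrakk> \<Longrightarrow> Q p"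
    and p: "p \<in> carrier E"
  shows "Q p"
proof -
  interpret P: tensor_pair \<I> E by (intro tensor_pair.intro I_ea E_ea)
  show ?thesis using X const p
  proof (induction X arbitrary: p rule: P.tensor_induct)
    case zero
    have one: "1 \<in> carrier \<I>" and z: "0 \<in> carrier \<I>" by (simp_all add: unit_interval_simps)
    have "scale E 1 (restr p \<zero>\<^bsub>\<I> \<otimes> E\<^esub>) = pure \<I> E 0 p"
      using additive_zero[OF IE_ea IE_ea additive_comp[OF restr_additive scale_additive[OF E_ea one]]]
        zero by (simp add: zero_pure)
    then have "const_on \<zero>\<^bsub>\<I> \<otimes> E\<^esub> p"
      unfolding const_on_def using one z by (intro bexI[of _ 1] bexI[of _ 0]) simp_all
    then show ?case by (rule zero.prems(1)[OF zero.prems(2)])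
  next
    case (add \<alpha> c X Y)
    show ?case
    proof (rule add.IH[OF _ add.prems(2)])
      fix p assume p: "p \<in> carrier E" and cp: "const_on X p"
      note cc = compl_closed[OF add.hyps(2)]
      have "Q (meet p d)" if d: "d \<in> carrier E" and "meet c (meet p d) = meet p d \<or> meet c (meet p d) = \<zero>" for d
        by (rule add.prems(1)[OF meet_closed[OF p d] const_on_add[OF add.hyps(3,1,2) _ add.hyps(4)]])
          (use p cp add that in \<open>simp_all add: const_on_meet meet_closed\<close>)
      moreover have "meet c (meet p c) = meet p c"
        using add.hyps(2) p by (simp add: meet_left_commute[of c p c] meet_idem)
      moreover have "meet c (meet p (compl c)) = \<zero>"
        using add.hyps(2) p cc meet_bot[of p] meet_comm[of p \<zero>] bot_closed
        by (simp add: meet_left_commute[of c p] meet_compl)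
      ultimately show "Q p"
        using join[OF _ _ meet_compl_split[OF p add.hyps(2)]] meet_closed p cc add.hyps(2) by blast
    qed
  qed
qed

text \<open>
  If \<open>\<Psi>\<close> is absolutely continuous with respect to \<open>\<Phi>\<close>, step functions with the same \<open>\<Phi>\<close>-integral over every
  \<open>p\<close> have the same \<open>\<Psi>\<close>-integral over every \<open>p\<close>: they agree except on a \<open>\<Phi>\<close>-null set.
\<close>

lemma restr_eq_of_null:
  fixes A :: "'b ea"
  assumes A: "effect_algebra A"
    and \<Phi>: "ea_additive (\<I> \<otimes> E) (\<I> \<otimes> A) \<Phi>" and \<Psi>: "ea_additive (\<I> \<otimes> E) (\<I> \<otimes> A) \<Psi>"
    and \<Phi>_scale: "\<And>\<alpha> X. \<lbrakk>\<alpha> \<in> carrier \<I>; X \<in> carrier (\<I> \<otimes> E)\<rbrakk> \<Longrightarrow> \<Phi> (scale E \<alpha> X) = scale A \<alpha> (\<Phi> X)"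
    and \<Psi>_scale: "\<And>\<alpha> X. \<lbrakk>\<alpha> \<in> carrier \<I>; X \<in> carrier (\<I> \<otimes> E)\<rbrakk> \<Longrightarrow> \<Psi> (scale E \<alpha> X) = scale A \<alpha> (\<Psi> X)"
    and null: "\<And>X. \<lbrakk>X \<in> carrier (\<I> \<otimes> E); \<Phi> X = \<zero>\<^bsub>\<I> \<otimes> A\<^esub>\<rbrakk> \<Longrightarrow> \<Psi> X = \<zero>\<^bsub>\<I> \<otimes> A\<^esub>"
    and X: "X \<in> carrier (\<I> \<otimes> E)" and Y: "Y \<in> carrier (\<I> \<otimes> E)"
    and eq: "\<And>p. p \<in> carrier E \<Longrightarrow> \<Phi> (restr p X) = \<Phi> (restr p Y)"
    and p: "p \<in> carrier E"
  shows "\<Psi> (restr p X) = \<Psi> (restr p Y)"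
proof -
  interpret TA: effect_algebra "\<I> \<otimes> A" by (rule I_tensor_effect_algebra[OF A])
  let ?Q = "\<lambda>p. \<Psi> (restr p X) = \<Psi> (restr p Y)"
  have join: "?Q r" if "p \<in> carrier E" "q \<in> carrier E" "p \<oplus> q = Some r" "?Q p" "?Q q" for p q r
  proof -
    have "\<Psi> (restr p Z) \<oplus>\<^bsub>\<I> \<otimes> A\<^esub> \<Psi> (restr q Z) = Some (\<Psi> (restr r Z))" if Z: "Z \<in> carrier (\<I> \<otimes> E)" for Z
      using additive_oplus[OF \<Psi> _ _ restr_add[OF _ _ _ Z]] restr_closed that \<open>p \<in> _\<close> \<open>q \<in> _\<close> \<open>p \<oplus> q = _\<close>
      by blast
    from this[OF X] this[OF Y] show ?thesis using that by simp
  qed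
  have base: "?Q p" if p: "p \<in> carrier E" and cX: "const_on X p" and cY: "const_on Y p" for p
  proof -
    define P where "P = pure \<I> E 1 p"
    have P: "P \<in> carrier (\<I> \<otimes> E)"
      unfolding P_def by (rule pure_closed[OF I_ea E_ea _ p]) (simp add: unit_interval_simps)
    have pP: "pure \<I> E \<alpha> p = scale E \<alpha> P" if "\<alpha> \<in> carrier \<I>" for \<alpha>
      unfolding P_def using that p by (simp add: scale_pure E_ea unit_interval_simps)
    obtain \<epsilon> \<alpha> where x: "\<epsilon> \<in> carrier \<I>" "\<alpha> \<in> carrier \<I>" "\<epsilon> > 0" "scale E \<epsilon> (restr p X) = scale E \<alpha> P"
      using cX pP by (auto simp: const_on_def)
    obtain \<delta> \<beta> where y: "\<delta> \<in> carrier \<I>" "\<beta> \<in> carrier \<I>" "\<delta> > 0" "scale E \<delta> (restr p Y) = scale E \<beta> P"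
      using cY pP by (auto simp: const_on_def)
    note rX = restr_closed[OF p X] and rY = restr_closed[OF p Y]
    \<comment> \<open>a common scaling factor, under which both functions become multiples of \<open>P\<close>\<close>
    let ?\<eta> = "\<delta> * \<epsilon>" and ?a = "\<delta> * \<alpha>" and ?b = "\<epsilon> * \<beta>"
    have cl: "?\<eta> \<in> carrier \<I>" "?a \<in> carrier \<I>" "?b \<in> carrier \<I>" using x y mult_closed by blast+
    have pos: "?\<eta> > 0" using x y by simp
    have eX: "scale E ?\<eta> (restr p X) = scale E ?a P"
      using x y scale_scale[OF E_ea y(1) x(1) rX] scale_scale[OF E_ea y(1) x(2) P] by simp
    have eY: "scale E ?\<eta> (restr p Y) = scale E ?b P"
      using x y scale_scale[OF E_ea x(1) y(1) rY] scale_scale[OF E_ea x(1) y(2) P]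
      by (simp add: mult.commute)
    show "?Q p"
    proof (cases "?a = ?b")
      case True
      then show ?thesis using scale_inject[OF E_ea rX rY cl(1) pos] eX eY by simp
    next
      case False
      have "scale A ?a (\<Phi> P) = scale A ?b (\<Phi> P)"
        using eX eY eq[OF p] \<Phi>_scale[OF cl(1) rX] \<Phi>_scale[OF cl(1) rY] \<Phi>_scale[OF cl(2) P]
          \<Phi>_scale[OF cl(3) P] by simp
      then have "\<Phi> P = \<zero>\<^bsub>\<I> \<otimes> A\<^esub>"
        using scale_eq_zero[OF A additive_closed[OF \<Phi> P]] cl False by (metis linorder_neqE)
      then have z: "\<Psi> P = \<zero>\<^bsub>\<I> \<otimes> A\<^esub>" by (rule null[OF P])
      have "scale A ?a \<zero>\<^bsub>\<I> \<otimes> A\<^esub> = scale A ?b \<zero>\<^bsub>\<I> \<otimes> A\<^esub>"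
        using additive_zero[OF TA.effect_algebra_axioms TA.effect_algebra_axioms scale_additive[OF A]] cl
        by simp
      then have "scale A ?\<eta> (\<Psi> (restr p X)) = scale A ?\<eta> (\<Psi> (restr p Y))"
        using eX eY z \<Psi>_scale[OF cl(1) rX] \<Psi>_scale[OF cl(1) rY] \<Psi>_scale[OF cl(2) P]
          \<Psi>_scale[OF cl(3) P] by simp
      then show ?thesis
        by (rule scale_inject[OF A additive_closed[OF \<Psi> rX] additive_closed[OF \<Psi> rY] cl(1) pos])
    qed
  qed
  show ?thesis
  proof (rule const_on_induct[OF X join _ p])
    fix p assume p: "p \<in> carrier E" and cX: "const_on X p"
    \<comment> \<open>inside a piece \<open>p\<close> on which \<open>X\<close> is constant, cut further until \<open>Y\<close> is constant too\<close>
    have "?Q (meet p q)" if q: "q \<in> carrier E" for q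
    proof (rule const_on_induct[OF Y _ _ q, of "\<lambda>q. ?Q (meet p q)"])
      fix q r s assume *: "q \<in> carrier E" "r \<in> carrier E" "q \<oplus> r = Some s" "?Q (meet p q)" "?Q (meet p r)"
      show "?Q (meet p s)"
        by (rule join[OF _ _ additive_oplus[OF meet_additive[OF p] *(1-3)] *(4,5)])
          (use * p meet_closed in simp_all)
    next
      fix q assume q: "q \<in> carrier E" and "const_on Y q"
      then have "const_on Y (meet p q)"
        using const_on_meet[OF Y q p] meet_comm[OF p q] by simp
      then show "?Q (meet p q)" using base const_on_meet[OF X p q cX] meet_closed[OF p q] by blast
    qed
    from this[OF top_closed] show "?Q p" by (simp add: meet_top p)
  qed
qed

end

section \<open>Causality\<close>

lemma BKerD:
  assumes "f \<in> BKer A B"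
  shows "BAlg A" "BAlg B" "Src f = A" "Arr f \<in> EAlg B (\<I> \<otimes> A)"
  using assms by (auto simp: BKer_def)

lemma kernel_eqI: "\<lbrakk>Src f = Src g; Arr f = Arr g\<rbrakk> \<Longrightarrow> f = (g :: ('a, 'b) kernel)"
  by (cases f, cases g) simp

theorem mainTheorem11:
  fixes A :: "'a ea" and B :: "'b ea" and C :: "'c ea" and D :: "'d ea"
    and f :: "('a, 'b) kernel" and g :: "('b, 'c) kernel" and h1 h2 :: "('c, 'd) kernel"
  assumes "f \<in> BKer A B" and "g \<in> BKer B C" and "h1 \<in> BKer C D" and "h2 \<in> BKer C D"
    and "(h1 \<otimes>\<^sub>K ker_id C) \<circ>\<^sub>K ker_copy C \<circ>\<^sub>K g \<circ>\<^sub>K f =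
         (h2 \<otimes>\<^sub>K ker_id C) \<circ>\<^sub>K ker_copy C \<circ>\<^sub>K g \<circ>\<^sub>K f"
  shows "(((h1 \<otimes>\<^sub>K ker_id C) \<circ>\<^sub>K ker_copy C \<circ>\<^sub>K g) \<otimes>\<^sub>K ker_id B) \<circ>\<^sub>K ker_copy B \<circ>\<^sub>K f =
         (((h2 \<otimes>\<^sub>K ker_id C) \<circ>\<^sub>K ker_copy C \<circ>\<^sub>K g) \<otimes>\<^sub>K ker_id B) \<circ>\<^sub>K ker_copy B \<circ>\<^sub>K f"
proof -
  note f = BKerD[OF assms(1)] and g = BKerD[OF assms(2)]
    and h1 = BKerD[OF assms(3)] and h2 = BKerD[OF assms(4)]
  have A: "effect_algebra A" and D: "effect_algebra D"
    using f(1) h1(2) by (auto elim!: BAlgE intro: boolean_ea.effect_algebra)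
  obtain mB jB cB where "boolean_ea B mB jB cB" by (rule BAlgE[OF f(2)])
  then interpret B: boolean_ea B mB jB cB .
  obtain mC jC cC where "boolean_ea C mC jC cC" by (rule BAlgE[OF g(2)])
  then interpret C: boolean_ea C mC jC cC .
  interpret TA: effect_algebra "\<I> \<otimes> A" by (rule I_tensor_effect_algebra[OF A])
  note DC = tensor_effect_algebra[OF D C.E_ea]
  define F where "F = app (kleisli_ext A (Arr f))"
  define G where "G = app (kleisli_ext B (Arr g))"
  note FE = kleisli_ext_EAlg[OF A B.E_ea f(4)] and GE = kleisli_ext_EAlg[OF B.E_ea C.E_ea g(4)]
  note F = EAlg_additive[OF FE, folded F_def] and G = EAlg_additive[OF GE, folded G_def]
  have F_scale: "F (scale B \<alpha> X) = scale A \<alpha> (F X)" if "\<alpha> \<in> carrier \<I>" "X \<in> carrier (\<I> \<otimes> B)" for \<alpha> X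
    unfolding F_def by (rule kleisli_ext_scale[OF A B.E_ea f(4) that])
  have G_scale: "G (scale C \<alpha> X) = scale B \<alpha> (G X)" if "\<alpha> \<in> carrier \<I>" "X \<in> carrier (\<I> \<otimes> C)" for \<alpha> X
    unfolding G_def by (rule kleisli_ext_scale[OF B.E_ea C.E_ea g(4) that])
  define k where "k h = (h \<otimes>\<^sub>K ker_id C) \<circ>\<^sub>K ker_copy C \<circ>\<^sub>K g" for h :: "('c, 'd) kernel"
  have k: "Src (k h) = B" "Arr (k h) \<in> EAlg (D \<otimes> C) (\<I> \<otimes> B)"
      "\<And>d c. \<lbrakk>d \<in> carrier D; c \<in> carrier C\<rbrakk> \<Longrightarrow>
        app (Arr (k h)) (pure D C d c) = G (C.restr c (app (Arr h) d))"
    if h: "Src h = C" "Arr h \<in> EAlg D (\<I> \<otimes> C)" for h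
  proof -
    note gr = C.graph_EAlg[OF D h] C.app_graph[OF D h]
    show "Src (k h) = B" by (simp add: k_def Src_ker_comp g(3))
    show "Arr (k h) \<in> EAlg (D \<otimes> C) (\<I> \<otimes> B)"
      unfolding k_def Arr_ker_comp[of _ g] g(3) by (rule ea_comp_EAlg[OF DC gr(1) GE])
    show "app (Arr (k h)) (pure D C d c) = G (C.restr c (app (Arr h) d))"
      if "d \<in> carrier D" "c \<in> carrier C" for d c
      unfolding k_def Arr_ker_comp[of _ g] g(3) G_def using that
      by (simp add: app_ea_comp[OF gr(1)] gr(2) pure_closed D C.E_ea)
  qed
  note k1 = k[OF h1(3,4)] and k2 = k[OF h2(3,4)]
  have hyp: "F (G (C.restr c (app (Arr h1) d))) = F (G (C.restr c (app (Arr h2) d)))"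
    if dc: "d \<in> carrier D" "c \<in> carrier C" for c d
  proof -
    have P: "pure D C d c \<in> carrier (D \<otimes> C)" by (rule pure_closed[OF D C.E_ea dc])
    have val: "app (Arr (k h \<circ>\<^sub>K f)) (pure D C d c) = F (G (C.restr c (app (Arr h) d)))"
      if h: "Src h = C" "Arr h \<in> EAlg D (\<I> \<otimes> C)" for h
      unfolding Arr_ker_comp f(3) F_def
      by (simp add: app_ea_comp[OF k(2)[OF h] P] k(3)[OF h dc])
    have "k h1 \<circ>\<^sub>K f = k h2 \<circ>\<^sub>K f" using assms(5) by (simp add: k_def)
    then show ?thesis using val[OF h1(3,4)] val[OF h2(3,4)] by simp
  qed
  have concl: "F (B.restr b (G (C.restr c (app (Arr h1) d)))) = F (B.restr b (G (C.restr c (app (Arr h2) d))))"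
    if d: "d \<in> carrier D" and c: "c \<in> carrier C" and b: "b \<in> carrier B" for b c d
  proof (rule C.restr_eq_of_null[OF A additive_comp[OF G F]
        additive_comp[OF additive_comp[OF G B.restr_additive[OF b]] F] _ _ _ _ _ hyp[OF d] c])
    fix \<alpha> X assume *: "\<alpha> \<in> carrier \<I>" "X \<in> carrier (\<I> \<otimes> C)"
    note GX = additive_closed[OF G *(2)]
    show "F (G (scale C \<alpha> X)) = scale A \<alpha> (F (G X))"
      by (simp only: G_scale[OF *] F_scale[OF *(1) GX])
    show "F (B.restr b (G (scale C \<alpha> X))) = scale A \<alpha> (F (B.restr b (G X)))"
      by (simp only: G_scale[OF *] B.restr_scale[OF b *(1) GX] F_scale[OF *(1) B.restr_closed[OF b GX]])
  next
    fix X assume X: "X \<in> carrier (\<I> \<otimes> C)" and zero: "F (G X) = \<zero>\<^bsub>\<I> \<otimes> A\<^esub>"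
    note GX = additive_closed[OF G X]
    \<comment> \<open>\<open>F (restr b (G X))\<close> is a summand of \<open>F (G X)\<close>, and summands of zero are zero\<close>
    obtain b' where b': "b' \<in> carrier B" "b \<oplus>\<^bsub>B\<^esub> b' = Some \<one>\<^bsub>B\<^esub>" using B.orthocomplement[OF b] by blast
    note r = B.restr_closed[OF b GX] B.restr_closed[OF b'(1) GX]
    have "F (B.restr b (G X)) \<oplus>\<^bsub>\<I> \<otimes> A\<^esub> F (B.restr b' (G X)) = Some \<zero>\<^bsub>\<I> \<otimes> A\<^esub>"
      using additive_oplus[OF F r B.restr_add[OF b b' GX]] by (simp only: B.restr_one[OF GX] zero)
    then show "F (B.restr b (G X)) = \<zero>\<^bsub>\<I> \<otimes> A\<^esub>"
      by (rule TA.oplus_eq_zero[OF additive_closed[OF F r(1)] additive_closed[OF F r(2)]])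
  qed (fact EAlg_closed[OF h1(4) d] EAlg_closed[OF h2(4) d])+
  show ?thesis
    unfolding k_def[symmetric]
  proof (rule kernel_eqI)
    note gr1 = B.graph_EAlg[OF DC k1(1,2)] B.app_graph[OF DC k1(1,2)]
      and gr2 = B.graph_EAlg[OF DC k2(1,2)] B.app_graph[OF DC k2(1,2)]
    have T: "effect_algebra ((D \<otimes> C) \<otimes> B)" by (rule tensor_effect_algebra[OF DC B.E_ea])
    show "Arr ((k h1 \<otimes>\<^sub>K ker_id B) \<circ>\<^sub>K ker_copy B \<circ>\<^sub>K f) = Arr ((k h2 \<otimes>\<^sub>K ker_id B) \<circ>\<^sub>K ker_copy B \<circ>\<^sub>K f)"
      unfolding Arr_ker_comp[of _ f] f(3)
    proof (rule EAlg_tensor_eqI_left[OF D C.E_ea B.E_ea I_tensor_effect_algebra[OF A]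
          ea_comp_EAlg[OF T gr1(1) FE] ea_comp_EAlg[OF T gr2(1) FE]])
      fix d c b assume *: "d \<in> carrier D" "c \<in> carrier C" "b \<in> carrier B"
      have P: "pure D C d c \<in> carrier (D \<otimes> C)" by (rule pure_closed[OF D C.E_ea *(1,2)])
      note PP = pure_closed[OF DC B.E_ea P *(3)]
      show "app (kleisli_ext A (Arr f) \<circ>\<^sub>E Arr ((k h1 \<otimes>\<^sub>K ker_id B) \<circ>\<^sub>K ker_copy B))
            (pure (D \<otimes> C) B (pure D C d c) b) =
          app (kleisli_ext A (Arr f) \<circ>\<^sub>E Arr ((k h2 \<otimes>\<^sub>K ker_id B) \<circ>\<^sub>K ker_copy B))
            (pure (D \<otimes> C) B (pure D C d c) b)"
        using concl[OF *]
        by (simp only: app_ea_comp[OF gr1(1) PP] app_ea_comp[OF gr2(1) PP] gr1(2)[OF P *(3)]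
            gr2(2)[OF P *(3)] k1(3)[OF *(1,2)] k2(3)[OF *(1,2)] F_def)
    qed
  qed (simp add: Src_ker_comp)
qed

end
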